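(* Let $\Gamma\subset\mathbb{R}$ be a separated set and let $\mathcal{G}\in W$. If the $\Gamma$-shifts of $\mathcal{G}$ are $l^2$-stable, then they are stable, i.e. they are $l^p$-stable for every $1\le p\le\infty$.
   Context: The Wiener amalgam space $W$ consists of measurable $f:\mathbb{R}\to\mathbb{C}$ with $\|f\|_W:=\sum_{k\in\mathbb{Z}}\|f\|_{L^\infty(k,k+1)}<\infty$. A set $\Gamma\subset\mathbb{R}$ is separated if $\inf_{\gamma,\gamma'\in\Gamma,\gamma\ne\gamma'}|\gamma-\gamma'|>0$. For $1\le p\le\infty$, the $\Gamma$-shifts of $\mathcal{G}$ are $l^p$-stable if there exist positive constants $C_1,C_2$ with $C_1\|\mathbf{c}\|_p\le\|\sum_{\gamma\in\Gamma}c_\gamma\mathcal{G}(\cdot-\gamma)\|_{L^p(\mathbb{R})}\le C_2\|\mathbf{c}\|_p$ for every $\mathbf{c}=\{c_\gamma\}\in l^p(\Gamma)$. *)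

theory Defs
  imports "HOL-Analysis.Analysis" "HOL-Probability.Essential_Supremum"
begin

text \<open>The value \<open>top\<close> at \<open>top\<close> is meant for exponents \<open>a > 0\<close> only.\<close>

definition ennreal_powr :: "ennreal \<Rightarrow> real \<Rightarrow> ennreal" where
  "ennreal_powr x a = (if x = top then top else ennreal (enn2real x powr a))"

text \<open>
  The extended \<open>L\<^sup>p\<close> norm of a complex function, for \<open>1 \<le> p \<le> \<infinity>\<close>.  As for \<^const>\<open>esssup\<close>,
  functions that are not measurable get the value \<open>\<infinity>\<close>, so \<open>f \<in> L\<^sup>p(M)\<close> iff \<open>Lp_norm p M f < top\<close>.
\<close>

definition Lp_norm :: "ennreal \<Rightarrow> 'a measure \<Rightarrow> ('a \<Rightarrow> complex) \<Rightarrow> ennreal" where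
  "Lp_norm p M f =
     (if f \<notin> borel_measurable M then top
      else if p = top then esssup M (\<lambda>x. ennreal (norm (f x)))
      else ennreal_powr (\<integral>\<^sup>+ x. ennreal (norm (f x) powr enn2real p) \<partial>M) (1 / enn2real p))"

text \<open>
  The norm of \<open>l\<^sup>p(\<Gamma>)\<close> is the \<open>L\<^sup>p\<close> norm for counting measure; values of a sequence outside
  the index set \<open>\<Gamma>\<close> are ignored.
\<close>

abbreviation lp_norm :: "ennreal \<Rightarrow> 'a set \<Rightarrow> ('a \<Rightarrow> complex) \<Rightarrow> ennreal" where
  "lp_norm p \<Gamma> c \<equiv> Lp_norm p (count_space \<Gamma>) c"

definition amalgam_norm :: "(real \<Rightarrow> complex) \<Rightarrow> ennreal" where
  "amalgam_norm f =
     (\<Sum>\<^sub>\<infinity>k\<in>(UNIV :: int set). Lp_norm top (lebesgue_on {real_of_int k<..<real_of_int k + 1}) f)"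

definition wiener_amalgam :: "(real \<Rightarrow> complex) set" where
  "wiener_amalgam = {f. f \<in> borel_measurable lebesgue \<and> amalgam_norm f < top}"

text \<open>
  The infimum is taken in \<open>[0,\<infinity>]\<close>, so that sets with at most one element are separated.
\<close>

definition separated :: "real set \<Rightarrow> bool" where
  "separated \<Gamma> \<longleftrightarrow>
     0 < (INF (\<gamma>, \<gamma>') \<in> {(\<gamma>, \<gamma>'). \<gamma> \<in> \<Gamma> \<and> \<gamma>' \<in> \<Gamma> \<and> \<gamma> \<noteq> \<gamma>'}. ennreal \<bar>\<gamma> - \<gamma>'\<bar>)"

lemma separated_iff_uniform_discrete: "separated \<Gamma> \<longleftrightarrow> uniform_discrete \<Gamma>"
proof
  assume "separated \<Gamma>"
  then obtain d where d: "0 < d"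
      "d < (INF (\<gamma>, \<gamma>') \<in> {(\<gamma>, \<gamma>'). \<gamma> \<in> \<Gamma> \<and> \<gamma>' \<in> \<Gamma> \<and> \<gamma> \<noteq> \<gamma>'}. ennreal \<bar>\<gamma> - \<gamma>'\<bar>)"
    unfolding separated_def using dense by blast
  have "d < top"
    using d(2) by (auto simp: less_top[symmetric])
  then have e: "0 < enn2real d" "ennreal (enn2real d) = d"
    using d(1) by (auto simp: enn2real_positive_iff)
  have "x = y" if "x \<in> \<Gamma>" "y \<in> \<Gamma>" "dist x y < enn2real d" for x y
  proof (rule ccontr)
    assume "x \<noteq> y"
    with that have "d < ennreal \<bar>x - y\<bar>"
      by (intro less_le_trans[OF d(2)] INF_lower2[where i = "(x, y)"]) auto
    then have "ennreal (enn2real d) < ennreal (dist x y)"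
      by (simp only: e dist_real_def)
    with that(3) show False
      by (simp add: ennreal_less_iff)
  qed
  with e(1) show "uniform_discrete \<Gamma>"
    unfolding uniform_discrete_def by blast
next
  assume "uniform_discrete \<Gamma>"
  then obtain e where e: "e > 0" "\<And>x y. x \<in> \<Gamma> \<Longrightarrow> y \<in> \<Gamma> \<Longrightarrow> dist x y < e \<Longrightarrow> x = y"
    unfolding uniform_discrete_def by blast
  have "ennreal e \<le> (INF (\<gamma>, \<gamma>') \<in> {(\<gamma>, \<gamma>'). \<gamma> \<in> \<Gamma> \<and> \<gamma>' \<in> \<Gamma> \<and> \<gamma> \<noteq> \<gamma>'}. ennreal \<bar>\<gamma> - \<gamma>'\<bar>)"
  proof (rule INF_greatest, clarify)
    fix x y assume "x \<in> \<Gamma>" "y \<in> \<Gamma>" "x \<noteq> y"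
    with e(2)[of x y] show "ennreal e \<le> ennreal \<bar>x - y\<bar>"
      by (intro ennreal_leI) (force simp: dist_real_def not_less[symmetric])
  qed
  with e(1) show "separated \<Gamma>"
    unfolding separated_def by (meson ennreal_less_zero_iff less_le_trans)
qed

text \<open>
  For separated \<open>\<Gamma>\<close>, a generator in the amalgam space and \<open>c \<in> l\<^sup>p(\<Gamma>)\<close>, the series converges
  absolutely for almost every \<open>x\<close>; \<^const>\<open>infsum\<close> is \<open>0\<close> on the exceptional null set.
\<close>

definition shift_series :: "real set \<Rightarrow> (real \<Rightarrow> complex) \<Rightarrow> (real \<Rightarrow> complex) \<Rightarrow> real \<Rightarrow> complex" where
  "shift_series \<Gamma> G c x = (\<Sum>\<^sub>\<infinity>\<gamma>\<in>\<Gamma>. c \<gamma> * G (x - \<gamma>))"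

definition lp_stable :: "ennreal \<Rightarrow> real set \<Rightarrow> (real \<Rightarrow> complex) \<Rightarrow> bool" where
  "lp_stable p \<Gamma> G \<longleftrightarrow>
     (\<exists>C1>0. \<exists>C2>0. \<forall>c. lp_norm p \<Gamma> c < top \<longrightarrow>
        ennreal C1 * lp_norm p \<Gamma> c \<le> Lp_norm p lebesgue (shift_series \<Gamma> G c) \<and>
        Lp_norm p lebesgue (shift_series \<Gamma> G c) \<le> ennreal C2 * lp_norm p \<Gamma> c)"

definition stable_shifts :: "real set \<Rightarrow> (real \<Rightarrow> complex) \<Rightarrow> bool" where
  "stable_shifts \<Gamma> G \<longleftrightarrow> (\<forall>p. 1 \<le> p \<longrightarrow> lp_stable p \<Gamma> G)"

end

theory Submission
  imports Defs
begin

text \<open>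
  Write \<open>T c = (\<Sum>\<gamma>. c \<gamma> * G (\<sqdot> - \<gamma>))\<close> and let \<open>A = T\<^sup>* T\<close> be the Gram matrix of the shifts, with entries
  \<open>A \<gamma> \<gamma>' = \<langle>G (\<sqdot> - \<gamma>'), G (\<sqdot> - \<gamma>)\<rangle>\<close>.  As \<open>G\<close> lies in the amalgam space and \<open>\<Gamma>\<close> is separated, all
  kernels involved are dominated by a summable function of the integer part of the distance to
  the diagonal.  Schur's test then bounds \<open>T\<close> and \<open>T\<^sup>*\<close> between \<open>l\<^sup>p\<close> and \<open>L\<^sup>p\<close> for every \<open>p\<close>, which
  gives the upper stability bound.  As \<open>A c = T\<^sup>* (T c)\<close>, the lower bound
  \<open>\<parallel>c\<parallel>\<^sub>p \<le> const * \<parallel>T c\<parallel>\<^sub>p\<close> follows from \<open>\<parallel>c\<parallel>\<^sub>p \<le> const * \<parallel>A c\<parallel>\<^sub>p\<close>.  The latter is a statement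
  about a matrix that is bounded below on \<open>l\<^sup>2\<close>, and it is proved by localization
  (lemmas \<open>localized_lower_bound\<close> and \<open>lp_lower_bound\<close>).

  Cut the line into blocks of length \<open>N\<close> and let \<open>\<psi>\<^sub>n\<close> be a plateau function that is \<open>1\<close> on block
  \<open>n\<close>, vanishes away from its two neighbours and has Lipschitz constant \<open>1 / N\<close>.  The \<open>l\<^sup>2\<close> bound, used
  only for the finitely supported sequence \<open>\<psi>\<^sub>n c\<close>, controls the \<open>l\<^sup>2\<close> size \<open>u n\<close> of \<open>c\<close> on block \<open>n\<close> by
  \<open>\<psi>\<^sub>n A c\<close> and the commutator \<open>[A, \<psi>\<^sub>n] c\<close>.  The commutator has entries
  \<open>A \<gamma> \<gamma>' * (\<psi>\<^sub>n \<gamma>' - \<psi>\<^sub>n \<gamma>)\<close>, whose modulus is at most \<open>\<bar>A \<gamma> \<gamma>'\<bar> * min 1 (\<bar>\<gamma> - \<gamma>'\<bar> / N)\<close>.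
  By dominated convergence its total off-diagonal mass tends to \<open>0\<close> as \<open>N\<close> grows, however slowly
  \<open>A\<close> decays.  The result is an inequality between sequences indexed by blocks,
  \<open>C * u n \<le> v n + (\<Sum>m. \<epsilon> n m * u m)\<close>, with \<open>v n\<close> the \<open>l\<^sup>1\<close> size of \<open>A c\<close> near block \<open>n\<close> and with \<open>\<epsilon>\<close>
  of small row and column sums.  It makes no reference to \<open>p\<close>: Schur's test gives
  \<open>\<parallel>\<epsilon> u\<parallel>\<^sub>p \<le> small * \<parallel>u\<parallel>\<^sub>p\<close>, and this term is absorbed into the left-hand side because
  \<open>\<parallel>u\<parallel>\<^sub>p\<close> is finite for \<open>c\<close> in \<open>l\<^sup>p\<close>.  Once \<open>N\<close> is fixed, a block contains boundedly many
  points, so that the \<open>l\<^sup>p\<close> norms of \<open>u\<close> and \<open>v\<close> are comparable to those of \<open>c\<close> and dominated by those of \<open>A c\<close>.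
\<close>

section \<open>\<open>L\<^sup>p\<close> norms of nonnegative functions and Schur's test\<close>

lemma ennreal_powr_ennreal: "0 \<le> r \<Longrightarrow> ennreal_powr (ennreal r) a = ennreal (r powr a)"
  by (simp add: ennreal_powr_def)

lemma ennreal_powr_top [simp]: "ennreal_powr top a = top"
  by (simp add: ennreal_powr_def)

lemma ennreal_powr_0 [simp]: "ennreal_powr 0 a = 0"
  by (simp add: ennreal_powr_def)

lemma ennreal_powr_mono: "x \<le> y \<Longrightarrow> 0 \<le> a \<Longrightarrow> ennreal_powr x a \<le> ennreal_powr y a"
  by (cases x; cases y) (auto simp: ennreal_powr_ennreal ennreal_le_iff2 powr_mono2 top_unique)

lemma ennreal_powr_mult:
  assumes "0 < a"
  shows "ennreal_powr (x * y) a = ennreal_powr x a * ennreal_powr y a"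
proof -
  have *: "ennreal_powr (top * z) a = top * ennreal_powr z a" for z
  proof (cases "z = 0")
    case False
    then have "ennreal_powr z a \<noteq> 0"
      by (auto simp: ennreal_powr_def enn2real_eq_0_iff)
    with False show ?thesis
      by (simp add: ennreal_top_mult)
  qed simp
  show ?thesis
  proof (cases "x = top \<or> y = top")
    case True
    then show ?thesis
      using *[of x] *[of y] by (auto simp: mult.commute)
  next
    case False
    then show ?thesis
      by (cases x; cases y)
        (auto simp: ennreal_powr_ennreal powr_mult ennreal_mult[symmetric])
  qed
qed

lemma ennreal_powr_powr:
  "ennreal_powr (ennreal_powr x a) b = ennreal_powr x (a * b)"
  by (cases x) (auto simp: ennreal_powr_ennreal powr_powr)

lemma ennreal_powr_1 [simp]: "ennreal_powr x 1 = x"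
  by (cases x) (auto simp: ennreal_powr_ennreal)

lemma ennreal_powr_eq_top_iff [simp]: "ennreal_powr x a = top \<longleftrightarrow> x = top"
  by (auto simp: ennreal_powr_def)

lemma measurable_ennreal_powr [measurable (raw)]:
  assumes [measurable]: "f \<in> borel_measurable M"
  shows "(\<lambda>x. ennreal_powr (f x) a) \<in> borel_measurable M"
  unfolding ennreal_powr_def by measurable

text \<open>
  The graph of the convex function \<open>u \<mapsto> u powr q\<close> lies above its tangent at \<open>t\<close>.
\<close>

lemma powr_tangent_le:
  fixes q t u :: real
  assumes "1 \<le> q" "0 < t" "0 \<le> u"
  shows "q * t powr (q - 1) * u \<le> u powr q + (q - 1) * t powr q"
proof (cases "u = 0")
  case False
  with assms have "0 < u" by simp
  have "(u powr q) powr (1 / q) * (t powr q) powr ((q - 1) / q)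
      \<le> 1 / q * u powr q + (q - 1) / q * t powr q"
    using assms \<open>0 < u\<close> by (intro Youngs_inequality_0) (auto simp: field_simps)
  also have "(u powr q) powr (1 / q) * (t powr q) powr ((q - 1) / q) = u * t powr (q - 1)"
    using assms \<open>0 < u\<close> by (simp add: powr_powr)
  finally show ?thesis
    using assms by (simp add: field_simps)
qed (use assms in auto)

text \<open>
  Jensen's inequality for a measure of density \<open>k\<close> and total mass at most \<open>R\<close>, in the form in
  which Schur's test uses it.  Integrating the tangent inequality at \<open>t\<close> and optimizing in \<open>t\<close>
  avoids normalizing \<open>k\<close> and treats infinite integrals along the way.
\<close>

lemma nn_integral_powr_le:
  assumes [measurable]: "k \<in> borel_measurable N" "u \<in> borel_measurable N"
    and k: "(\<integral>\<^sup>+y. k y \<partial>N) \<le> ennreal R" and R: "0 < R" and q: "1 \<le> q"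
  shows "ennreal_powr (\<integral>\<^sup>+y. k y * u y \<partial>N) q
    \<le> ennreal (R powr (q - 1)) * (\<integral>\<^sup>+y. k y * ennreal_powr (u y) q \<partial>N)"
proof -
  define S where "S = (\<integral>\<^sup>+y. k y * u y \<partial>N)"
  define Q where "Q = (\<integral>\<^sup>+y. k y * ennreal_powr (u y) q \<partial>N)"
  have tangent: "ennreal (q * t powr (q - 1)) * S \<le> Q + ennreal ((q - 1) * t powr q * R)"
    if t: "0 < t" for t
  proof -
    have pt: "ennreal (q * t powr (q - 1)) * w \<le> ennreal_powr w q + ennreal ((q - 1) * t powr q)"
      for w
    proof (cases w)
      case (real r)
      then show ?thesis
        using powr_tangent_le[OF q t, of r] q
        by (simp add: ennreal_powr_ennreal ennreal_mult[symmetric] ennreal_plus[symmetric]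
            del: ennreal_plus)
    qed simp
    have "ennreal (q * t powr (q - 1)) * S
        = (\<integral>\<^sup>+y. k y * (ennreal (q * t powr (q - 1)) * u y) \<partial>N)"
      unfolding S_def by (subst nn_integral_cmult[symmetric]) (auto simp: ac_simps)
    also have "\<dots> \<le> (\<integral>\<^sup>+y. k y * (ennreal_powr (u y) q + ennreal ((q - 1) * t powr q)) \<partial>N)"
      by (intro nn_integral_mono mult_left_mono pt) auto
    also have "\<dots> = Q + (\<integral>\<^sup>+y. k y \<partial>N) * ennreal ((q - 1) * t powr q)"
      unfolding Q_def by (simp add: distrib_left nn_integral_add nn_integral_multc)
    also have "\<dots> \<le> Q + ennreal R * ennreal ((q - 1) * t powr q)"
      using k by (intro add_left_mono mult_right_mono) auto
    finally show ?thesis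
      using q R by (simp add: ennreal_mult[symmetric] ac_simps)
  qed
  have "ennreal_powr S q \<le> ennreal (R powr (q - 1)) * Q"
  proof (cases S)
    case top
    then have "Q = top"
      using tangent[of 1] q by (auto simp: ennreal_mult_top top_unique)
    then show ?thesis
      using R by (simp add: ennreal_mult_top)
  next
    case (real s)
    show ?thesis
    proof (cases "s = 0 \<or> Q = top")
      case True
      then show ?thesis
        using real R by (auto simp: ennreal_mult_top)
    next
      case False
      then obtain r where r: "Q = ennreal r" "0 \<le> r"
        by (cases Q) auto
      have s: "0 < s"
        using False real by auto
      have eq: "(s / R) powr (q - 1) * s = (s / R) powr q * R"
        using s R by (simp add: powr_diff)
      \<comment> \<open>The tangent at the mean value \<open>s / R\<close> gives the best bound.\<close>
      have "q * ((s / R) powr (q - 1) * s) \<le> r + (q - 1) * (s / R) powr q * R"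
        using tangent[of "s / R"] s R q r real
        by (simp add: ennreal_mult[symmetric] ennreal_plus[symmetric] ac_simps del: ennreal_plus)
      then have "(s / R) powr q * R \<le> r"
        unfolding eq by (simp add: algebra_simps)
      then have "s powr q \<le> R powr (q - 1) * r"
        using s R by (simp add: powr_divide powr_diff field_simps)
      then show ?thesis
        using real r by (simp add: ennreal_powr_ennreal ennreal_mult[symmetric])
    qed
  qed
  then show ?thesis
    by (simp add: S_def Q_def)
qed

text \<open>
  All estimates below are between nonnegative functions that may be infinite; this version of
  \<^const>\<open>Lp_norm\<close> spares integrability side conditions.
\<close>

definition nn_Lp :: "ennreal \<Rightarrow> 'a measure \<Rightarrow> ('a \<Rightarrow> ennreal) \<Rightarrow> ennreal" where
  "nn_Lp p M f =
     (if p = top then esssup M f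
      else ennreal_powr (\<integral>\<^sup>+x. ennreal_powr (f x) (enn2real p) \<partial>M) (1 / enn2real p))"

lemma Lp_norm_eq_nn_Lp:
  assumes "f \<in> borel_measurable M"
  shows "Lp_norm p M f = nn_Lp p M (\<lambda>x. ennreal (norm (f x)))"
  using assms by (simp add: Lp_norm_def nn_Lp_def ennreal_powr_ennreal)

lemma enn2real_ge_1: "1 \<le> p \<Longrightarrow> p \<noteq> top \<Longrightarrow> 1 \<le> enn2real p" for p :: ennreal
  by (cases p) (auto simp: ennreal_1[symmetric] simp del: ennreal_1)

lemma nn_Lp_mono:
  assumes [measurable]: "f \<in> borel_measurable M" "g \<in> borel_measurable M"
    and "\<And>x. x \<in> space M \<Longrightarrow> f x \<le> g x" and p: "1 \<le> p"
  shows "nn_Lp p M f \<le> nn_Lp p M g"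
proof (cases "p = top")
  case True
  then show ?thesis
    using assms by (auto simp: nn_Lp_def intro!: esssup_AE_mono)
next
  case False
  then show ?thesis
    using assms enn2real_ge_1[OF p]
    by (auto simp: nn_Lp_def intro!: ennreal_powr_mono nn_integral_mono)
qed

text \<open>
  For \<open>p = \<infinity>\<close> this is the estimate by row sums.  For finite \<open>p\<close> the rows enter through Jensen's
  inequality and the columns through Tonelli's theorem.  This is the only tool by which norms with
  different \<open>p\<close> are treated; most of the kernels to which it is applied below are indicators of
  a neighbourhood relation.
\<close>

lemma Schur_test:
  assumes "pair_sigma_finite M N"
    and K [measurable]: "case_prod K \<in> borel_measurable (M \<Otimes>\<^sub>M N)"
    and [measurable]: "u \<in> borel_measurable N" "f \<in> borel_measurable M"
    and rows: "\<And>x. x \<in> space M \<Longrightarrow> (\<integral>\<^sup>+y. K x y \<partial>N) \<le> ennreal R"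
    and cols: "\<And>y. y \<in> space N \<Longrightarrow> (\<integral>\<^sup>+x. K x y \<partial>M) \<le> ennreal R"
    and f: "\<And>x. x \<in> space M \<Longrightarrow> f x \<le> (\<integral>\<^sup>+y. K x y * u y \<partial>N)"
    and R: "0 < R" and p: "1 \<le> p"
  shows "nn_Lp p M f \<le> ennreal R * nn_Lp p N u"
proof -
  interpret pair_sigma_finite M N by fact
  have Kx [measurable]: "K x \<in> borel_measurable N" if "x \<in> space M" for x
    using measurable_compose[OF measurable_Pair1'[OF that] K] by simp
  show ?thesis
  proof (cases "p = top")
    case True
    have "f x \<le> ennreal R * esssup N u" if x: "x \<in> space M" for x
    proof -
      have [measurable]: "K x \<in> borel_measurable N" by (rule Kx[OF x])
      have "f x \<le> (\<integral>\<^sup>+y. K x y * u y \<partial>N)"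
        by (rule f[OF x])
      also have "\<dots> \<le> (\<integral>\<^sup>+y. K x y * esssup N u \<partial>N)"
      proof (rule nn_integral_mono_AE)
        show "AE y in N. K x y * u y \<le> K x y * esssup N u"
          using esssup_AE[of u N] by eventually_elim (rule mult_left_mono, auto)
      qed
      also have "\<dots> = (\<integral>\<^sup>+y. K x y \<partial>N) * esssup N u"
        by (simp add: nn_integral_multc)
      also have "\<dots> \<le> ennreal R * esssup N u"
        by (intro mult_right_mono rows x) auto
      finally show ?thesis .
    qed
    with True show ?thesis
      by (auto simp: nn_Lp_def intro!: esssup_I)
  next
    case False
    define q where "q = enn2real p"
    have q: "1 \<le> q"
      unfolding q_def using p False by (rule enn2real_ge_1)
    let ?U = "\<integral>\<^sup>+y. ennreal_powr (u y) q \<partial>N"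
    have "(\<integral>\<^sup>+x. ennreal_powr (f x) q \<partial>M)
        \<le> (\<integral>\<^sup>+x. ennreal (R powr (q - 1)) * (\<integral>\<^sup>+y. K x y * ennreal_powr (u y) q \<partial>N) \<partial>M)"
    proof (rule nn_integral_mono)
      fix x assume x: "x \<in> space M"
      have "ennreal_powr (f x) q \<le> ennreal_powr (\<integral>\<^sup>+y. K x y * u y \<partial>N) q"
        using f[OF x] q by (intro ennreal_powr_mono) auto
      also have "\<dots> \<le> ennreal (R powr (q - 1)) * (\<integral>\<^sup>+y. K x y * ennreal_powr (u y) q \<partial>N)"
        using Kx[OF x] rows[OF x] R q by (intro nn_integral_powr_le) auto
      finally show "ennreal_powr (f x) q \<le> \<dots>" .
    qed
    also have "\<dots> = ennreal (R powr (q - 1))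
        * (\<integral>\<^sup>+x. \<integral>\<^sup>+y. K x y * ennreal_powr (u y) q \<partial>N \<partial>M)"
      by (rule nn_integral_cmult) measurable
    also have "(\<integral>\<^sup>+x. \<integral>\<^sup>+y. K x y * ennreal_powr (u y) q \<partial>N \<partial>M)
        = (\<integral>\<^sup>+y. \<integral>\<^sup>+x. K x y * ennreal_powr (u y) q \<partial>M \<partial>N)"
      by (rule Fubini'[symmetric]) measurable
    also have "\<dots> = (\<integral>\<^sup>+y. (\<integral>\<^sup>+x. K x y \<partial>M) * ennreal_powr (u y) q \<partial>N)"
    proof (rule nn_integral_cong)
      fix y assume y: "y \<in> space N"
      have [measurable]: "(\<lambda>x. K x y) \<in> borel_measurable M"
        using measurable_compose[OF measurable_Pair2'[OF y] K] by simp
      show "(\<integral>\<^sup>+x. K x y * ennreal_powr (u y) q \<partial>M) = (\<integral>\<^sup>+x. K x y \<partial>M) * ennreal_powr (u y) q"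
        by (rule nn_integral_multc) measurable
    qed
    also have "ennreal (R powr (q - 1)) * \<dots> \<le> ennreal (R powr (q - 1))
        * (\<integral>\<^sup>+y. ennreal R * ennreal_powr (u y) q \<partial>N)"
      by (intro mult_left_mono nn_integral_mono mult_right_mono cols) auto
    also have "\<dots> = ennreal (R powr q) * ?U"
      using R by (simp add: nn_integral_cmult mult.assoc[symmetric] ennreal_mult[symmetric] powr_diff)
    finally have "nn_Lp p M f \<le> ennreal_powr (ennreal (R powr q) * ?U) (1 / q)"
      using q False by (auto simp: nn_Lp_def q_def intro!: ennreal_powr_mono)
    also have "\<dots> = ennreal R * nn_Lp p N u"
      using q False R
      by (simp add: ennreal_powr_mult ennreal_powr_ennreal nn_Lp_def q_def powr_powr)
    finally show ?thesis .
  qed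
qed

text \<open>
  A quasi-triangle inequality suffices for the absorption argument.  The constant \<open>4\<close> comes from
  applying \<open>(a + b) powr r \<le> 2 powr r * (a powr r + b powr r)\<close> twice, under the integral
  with \<open>r = p\<close> and outside it with \<open>r = 1 / p \<le> 1\<close>.
\<close>

lemma nn_Lp_add_le:
  assumes [measurable]: "f \<in> borel_measurable M" "g \<in> borel_measurable M" and p: "1 \<le> p"
  shows "nn_Lp p M (\<lambda>x. f x + g x) \<le> 4 * (nn_Lp p M f + nn_Lp p M g)"
proof (cases "p = top")
  case True
  have "esssup M (\<lambda>x. f x + g x) \<le> esssup M f + esssup M g"
  proof (rule esssup_I)
    show "AE x in M. f x + g x \<le> esssup M f + esssup M g"
      using esssup_AE[of f M] esssup_AE[of g M] by eventually_elim (rule add_mono)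
  qed measurable
  also have "\<dots> \<le> 4 * (esssup M f + esssup M g)"
    using mult_right_mono[of 1 4 "esssup M f + esssup M g"] by simp
  finally show ?thesis
    using True by (simp add: nn_Lp_def)
next
  case False
  define q where "q = enn2real p"
  have q: "1 \<le> q"
    unfolding q_def using p False by (rule enn2real_ge_1)
  have add_le: "ennreal_powr (a + b) r \<le> ennreal_powr 2 r * (ennreal_powr a r + ennreal_powr b r)"
    if "0 < r" for a b r
  proof -
    have "a + b \<le> 2 * max a b"
      unfolding mult_2 by (intro add_mono) auto
    then have "ennreal_powr (a + b) r \<le> ennreal_powr 2 r * ennreal_powr (max a b) r"
      using that by (simp add: ennreal_powr_mono ennreal_powr_mult[symmetric])
    also have "\<dots> \<le> ennreal_powr 2 r * (ennreal_powr a r + ennreal_powr b r)"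
      by (intro mult_left_mono) (auto simp: max_def)
    finally show ?thesis .
  qed
  have "(\<integral>\<^sup>+x. ennreal_powr (f x + g x) q \<partial>M)
      \<le> (\<integral>\<^sup>+x. ennreal_powr 2 q * (ennreal_powr (f x) q + ennreal_powr (g x) q) \<partial>M)"
    using q by (intro nn_integral_mono add_le) auto
  also have "\<dots> = ennreal_powr 2 q
      * ((\<integral>\<^sup>+x. ennreal_powr (f x) q \<partial>M) + (\<integral>\<^sup>+x. ennreal_powr (g x) q \<partial>M))" (is "_ = _ * (?F + ?G)")
    by (simp add: nn_integral_cmult nn_integral_add)
  finally have "nn_Lp p M (\<lambda>x. f x + g x) \<le> ennreal_powr (ennreal_powr 2 q * (?F + ?G)) (1 / q)"
    using q False by (auto simp: nn_Lp_def q_def intro!: ennreal_powr_mono)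
  also have "\<dots> = 2 * ennreal_powr (?F + ?G) (1 / q)"
    using q by (simp add: ennreal_powr_mult ennreal_powr_powr)
  also have "\<dots> \<le> 2 * (ennreal_powr 2 (1 / q) * (ennreal_powr ?F (1 / q) + ennreal_powr ?G (1 / q)))"
    using q by (intro mult_left_mono add_le) auto
  also have "\<dots> \<le> 2 * (2 * (ennreal_powr ?F (1 / q) + ennreal_powr ?G (1 / q)))"
  proof -
    have "ennreal_powr 2 (1 / q) \<le> 2"
      using q powr_mono[of "1 / q" 1 2] ennreal_powr_ennreal[of 2 "1 / q"]
        ennreal_leI[of "2 powr (1 / q)" 2] by simp
    then show ?thesis
      by (intro mult_left_mono mult_right_mono) auto
  qed
  finally show ?thesis
    using False by (simp add: nn_Lp_def q_def mult.assoc[symmetric])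
qed

text \<open>
  A perturbation \<open>w\<close> that is small compared with \<open>u\<close> itself can be dropped from an upper bound
  for \<open>u\<close>, provided that the norm of \<open>u\<close> is finite.
\<close>

lemma nn_Lp_absorb:
  assumes [measurable]: "u \<in> borel_measurable M" "v \<in> borel_measurable M" "w \<in> borel_measurable M"
    and le: "\<And>x. x \<in> space M \<Longrightarrow> u x \<le> v x + w x"
    and w: "8 * nn_Lp p M w \<le> nn_Lp p M u"
    and fin: "nn_Lp p M u < top" and p: "1 \<le> p"
  shows "nn_Lp p M u \<le> 8 * nn_Lp p M v"
proof -
  have "nn_Lp p M u \<le> nn_Lp p M (\<lambda>x. v x + w x)"
    using le p by (intro nn_Lp_mono) auto
  also have "\<dots> \<le> 4 * (nn_Lp p M v + nn_Lp p M w)"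
    by (intro nn_Lp_add_le p) auto
  finally have u: "nn_Lp p M u \<le> 4 * (nn_Lp p M v + nn_Lp p M w)" .
  have "nn_Lp p M w < top"
  proof (rule ccontr)
    assume "\<not> nn_Lp p M w < top"
    then have "8 * nn_Lp p M w = top"
      by (simp add: less_top[symmetric] ennreal_mult_top)
    with w fin show False
      by (simp add: top_unique)
  qed
  show ?thesis
  proof (cases "nn_Lp p M v")
    case (real a)
    obtain b where b: "nn_Lp p M w = ennreal b" "0 \<le> b"
      using \<open>nn_Lp p M w < top\<close> by (cases "nn_Lp p M w") auto
    obtain c where c: "nn_Lp p M u = ennreal c" "0 \<le> c"
      using fin by (cases "nn_Lp p M u") auto
    have "ennreal c \<le> ennreal (4 * (a + b))"
      using u b c real by (simp add: ennreal_mult)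
    then have "c \<le> 4 * (a + b)"
      using b real by (subst (asm) ennreal_le_iff) auto
    moreover have "ennreal (8 * b) \<le> ennreal c"
      using w b c by (simp add: ennreal_mult)
    then have "8 * b \<le> c"
      using c by (subst (asm) ennreal_le_iff) auto
    ultimately have "c \<le> 8 * a"
      by simp
    then have "ennreal c \<le> ennreal (8 * a)"
      by (rule ennreal_leI)
    with real c show ?thesis
      by (simp add: ennreal_mult)
  qed (simp add: ennreal_mult_top)
qed

lemma le_nn_Lp_count_space:
  assumes "a \<in> A" "1 \<le> p"
  shows "f a \<le> nn_Lp p (count_space A) f"
proof (cases "p = top")
  case True
  then show ?thesis
    using esssup_AE[of f "count_space A"] assms by (simp add: nn_Lp_def AE_count_space)
next
  case False
  define q where "q = enn2real p"
  have q: "1 \<le> q"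
    unfolding q_def using assms(2) False by (rule enn2real_ge_1)
  have "f a = ennreal_powr (ennreal_powr (f a) q) (1 / q)"
    using q by (simp add: ennreal_powr_powr)
  also have "\<dots> \<le> ennreal_powr (\<integral>\<^sup>+x. ennreal_powr (f x) q \<partial>count_space A) (1 / q)"
    using q nn_integral_ge_point[OF assms(1), of "\<lambda>x. ennreal_powr (f x) q"]
    by (intro ennreal_powr_mono) simp_all
  also have "\<dots> = nn_Lp p (count_space A) f"
    using False by (simp add: nn_Lp_def q_def)
  finally show ?thesis .
qed

section \<open>Sums, integrals and counting\<close>

lemma nn_integral_swap_count_space:
  fixes f :: "'a \<Rightarrow> 'b \<Rightarrow> ennreal"
  assumes "countable A" "countable B"
  shows "(\<integral>\<^sup>+a. \<integral>\<^sup>+b. f a b \<partial>count_space B \<partial>count_space A)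
    = (\<integral>\<^sup>+b. \<integral>\<^sup>+a. f a b \<partial>count_space A \<partial>count_space B)"
proof -
  interpret pair_sigma_finite "count_space A" "count_space B"
    using assms by (intro pair_sigma_finite.intro sigma_finite_measure_count_space_countable)
  show ?thesis
    using assms by (intro Fubini'[symmetric]) (simp add: pair_measure_countable)
qed

lemma measurable_pair_count_space:
  assumes "countable A" and f: "\<And>a. a \<in> A \<Longrightarrow> (\<lambda>x. f x a) \<in> borel_measurable M"
  shows "case_prod f \<in> borel_measurable (M \<Otimes>\<^sub>M count_space A)"
proof -
  have "case_prod (\<lambda>a x. f x a) \<in> borel_measurable (count_space A \<Otimes>\<^sub>M M)"
    using assms by (intro measurable_pair_measure_countable1) auto
  then show ?thesis
    by (subst measurable_pair_swap_iff) (simp add: case_prod_unfold)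
qed

text \<open>
  Counting: each value \<open>h k\<close> is taken at the at most \<open>K\<close> points of the fibre over \<open>k\<close>.
\<close>

lemma nn_integral_fibres_le:
  fixes s :: "'a \<Rightarrow> 'b" and h :: "'b \<Rightarrow> ennreal"
  assumes "countable A" "countable B" and s: "\<And>a. a \<in> A \<Longrightarrow> s a \<in> B"
    and fib: "\<And>k. k \<in> B \<Longrightarrow> finite {a \<in> A. s a = k} \<and> card {a \<in> A. s a = k} \<le> K"
  shows "(\<integral>\<^sup>+a. h (s a) \<partial>count_space A) \<le> of_nat K * (\<integral>\<^sup>+k. h k \<partial>count_space B)"
proof -
  have "(\<integral>\<^sup>+a. h (s a) \<partial>count_space A)
      = (\<integral>\<^sup>+a. \<integral>\<^sup>+k. h k * indicator {s a} k \<partial>count_space B \<partial>count_space A)"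
    using s by (intro nn_integral_cong) simp
  also have "\<dots> = (\<integral>\<^sup>+k. \<integral>\<^sup>+a. h k * indicator {s a} k \<partial>count_space A \<partial>count_space B)"
    by (rule nn_integral_swap_count_space) fact+
  also have "\<dots> = (\<integral>\<^sup>+k. h k * of_nat (card {a \<in> A. s a = k}) \<partial>count_space B)"
  proof (rule nn_integral_cong)
    fix k assume "k \<in> space (count_space B)"
    then have k: "k \<in> B" by simp
    have "(\<integral>\<^sup>+a. h k * indicator {s a} k \<partial>count_space A)
        = (\<integral>\<^sup>+a. h k * indicator {a \<in> A. s a = k} a \<partial>count_space A)"
      by (intro nn_integral_cong) (auto split: split_indicator)
    also have "\<dots> = h k * of_nat (card {a \<in> A. s a = k})"
      using fib[OF k] by (simp add: nn_integral_cmult_indicator)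
    finally show "(\<integral>\<^sup>+a. h k * indicator {s a} k \<partial>count_space A)
        = h k * of_nat (card {a \<in> A. s a = k})" .
  qed
  also have "\<dots> \<le> (\<integral>\<^sup>+k. of_nat K * h k \<partial>count_space B)"
  proof (rule nn_integral_mono)
    fix k assume "k \<in> space (count_space B)"
    then have "(of_nat (card {a \<in> A. s a = k}) :: ennreal) \<le> of_nat K"
      using fib[of k] by (intro of_nat_mono) auto
    then show "h k * of_nat (card {a \<in> A. s a = k}) \<le> of_nat K * h k"
      by (subst mult.commute) (rule mult_right_mono, auto)
  qed
  also have "\<dots> = of_nat K * (\<integral>\<^sup>+k. h k \<partial>count_space B)"
    by (rule nn_integral_cmult) simp
  finally show ?thesis .
qed

lemma nn_integral_count_space_int_shift:
  fixes \<phi> :: "int \<Rightarrow> ennreal"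
  shows "(\<integral>\<^sup>+i. \<phi> (i + j) \<partial>count_space UNIV) = (\<integral>\<^sup>+i. \<phi> i \<partial>count_space UNIV)"
  by (rule nn_integral_bij_count_space)
    (auto simp: bij_betw_def inj_on_def intro!: image_eqI[of _ "\<lambda>i. i + j" "_ - j"])

lemma nn_integral_count_space_int_reflect:
  fixes \<phi> :: "int \<Rightarrow> ennreal"
  shows "(\<integral>\<^sup>+i. \<phi> (j - i) \<partial>count_space UNIV) = (\<integral>\<^sup>+i. \<phi> i \<partial>count_space UNIV)"
  by (rule nn_integral_bij_count_space)
    (auto simp: bij_betw_def inj_on_def intro!: image_eqI[of _ "\<lambda>i. j - i" "j - _"])

text \<open>
  The integer part maps Lebesgue measure to counting measure, since each cell \<open>[k, k + 1)\<close> has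
  length \<open>1\<close>.
\<close>

lemma nn_integral_floor:
  fixes \<phi> :: "int \<Rightarrow> ennreal"
  shows "(\<integral>\<^sup>+x. \<phi> \<lfloor>x :: real\<rfloor> \<partial>lborel) = (\<integral>\<^sup>+k. \<phi> k \<partial>count_space UNIV)"
proof -
  have [measurable]: "(floor :: real \<Rightarrow> int) \<in> borel \<rightarrow>\<^sub>M count_space UNIV"
    by measurable
  have "distr lborel (count_space UNIV) (floor :: real \<Rightarrow> int) = count_space UNIV"
  proof (rule measure_eqI_countable[of _ UNIV])
    fix k :: int
    have "(floor :: real \<Rightarrow> int) -` {k} = {real_of_int k..<real_of_int k + 1}"
      by (auto simp: floor_eq_iff)
    then show "emeasure (distr lborel (count_space UNIV) (floor :: real \<Rightarrow> int)) {k}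
        = emeasure (count_space UNIV) {k}"
      by (subst emeasure_distr) auto
  qed auto
  then have "(\<integral>\<^sup>+k. \<phi> k \<partial>count_space UNIV)
      = (\<integral>\<^sup>+k. \<phi> k \<partial>distr lborel (count_space UNIV) (floor :: real \<Rightarrow> int))"
    by simp
  also have "\<dots> = (\<integral>\<^sup>+x. \<phi> \<lfloor>x :: real\<rfloor> \<partial>lborel)"
    by (rule nn_integral_distr) simp_all
  finally show ?thesis ..
qed

lemma nn_integral_lborel_translate:
  fixes t :: real
  assumes [measurable]: "f \<in> borel_measurable borel"
  shows "(\<integral>\<^sup>+x. f (x - t) \<partial>lborel) = (\<integral>\<^sup>+x. f x \<partial>lborel)"
  using nn_integral_real_affine[of f 1 "- t"] by (simp add: algebra_simps)

lemma infsum_eq_lebesgue_integral_count_space: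
  fixes f :: "'a \<Rightarrow> 'b :: {banach, second_countable_topology}"
  assumes "integrable (count_space A) f"
  shows "infsum f A = (LINT a|count_space A. f a)"
  using infsetsum_infsum[of f A] assms
  by (metis abs_summable_equivalent abs_summable_on_def infsetsum_def)

text \<open>
  If \<open>f\<close> is not integrable, the left-hand side is \<open>0\<close> by convention.
\<close>

lemma norm_lebesgue_integral_le:
  fixes f :: "'a \<Rightarrow> complex"
  shows "ennreal (norm (LINT x|M. f x)) \<le> (\<integral>\<^sup>+x. ennreal (norm (f x)) \<partial>M)"
  by (cases "integrable M f") (auto simp: integral_norm_bound_ennreal not_integrable_integral_eq)

lemma nn_integral_count_space_int_le_infsum:
  fixes g :: "int \<Rightarrow> ennreal"
  shows "(\<integral>\<^sup>+k. g k \<partial>count_space UNIV) \<le> (\<Sum>\<^sub>\<infinity>k\<in>UNIV. g k)"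
proof -
  have "(\<integral>\<^sup>+k. g k \<partial>count_space UNIV) = (\<integral>\<^sup>+i. g (int_decode i) \<partial>count_space UNIV)"
    by (rule nn_integral_bij_count_space[OF bij_int_decode, symmetric])
  also have "\<dots> = (\<Sum>i. g (int_decode i))"
    by (rule nn_integral_count_space_nat)
  also have "\<dots> \<le> (\<Sum>\<^sub>\<infinity>k\<in>UNIV. g k)"
  proof (rule suminf_le_const)
    fix n
    have "(\<Sum>i<n. g (int_decode i)) = sum g (int_decode ` {..<n})"
      by (subst sum.reindex) (auto intro: inj_on_subset[OF inj_int_decode])
    also have "\<dots> \<le> (\<Sum>\<^sub>\<infinity>k\<in>UNIV. g k)"
      by (subst nonneg_infsum_complete) (auto intro!: SUP_upper)
    finally show "(\<Sum>i<n. g (int_decode i)) \<le> (\<Sum>\<^sub>\<infinity>k\<in>UNIV. g k)" .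
  qed simp
  finally show ?thesis .
qed

text \<open>
  Schur's test on \<open>l\<^sup>2\<close> in dual form.  It follows from
  \<open>x i * y j \<le> a * (x i)\<^sup>2 + b * (y j)\<^sup>2\<close> with weights \<open>a\<close> and \<open>b\<close> that
  balance the two norms.
\<close>

lemma bilinear_Schur_test:
  fixes k :: "'a \<Rightarrow> 'b \<Rightarrow> ennreal" and x :: "'a \<Rightarrow> real" and y :: "'b \<Rightarrow> real"
  assumes "finite I" "finite J"
    and rows: "\<And>i. i \<in> I \<Longrightarrow> (\<Sum>j\<in>J. k i j) \<le> E"
    and cols: "\<And>j. j \<in> J \<Longrightarrow> (\<Sum>i\<in>I. k i j) \<le> E"
    and nonneg: "\<And>i. 0 \<le> x i" "\<And>j. 0 \<le> y j"
  shows "(\<Sum>i\<in>I. \<Sum>j\<in>J. ennreal (x i) * k i j * ennreal (y j))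
    \<le> E * ennreal (L2_set x I * L2_set y J)"
proof (cases "L2_set x I = 0 \<or> L2_set y J = 0")
  case True
  then have "(\<forall>i\<in>I. x i = 0) \<or> (\<forall>j\<in>J. y j = 0)"
    using assms by (simp add: L2_set_eq_0_iff)
  then have "(\<Sum>i\<in>I. \<Sum>j\<in>J. ennreal (x i) * k i j * ennreal (y j)) = 0"
    by (intro sum.neutral ballI) auto
  then show ?thesis by (metis zero_le)
next
  case False
  define X where "X = L2_set x I"
  define Y where "Y = L2_set y J"
  have pos: "0 < X" "0 < Y"
    using False by (simp_all add: X_def Y_def less_le)
  have X2: "(\<Sum>i\<in>I. (x i)\<^sup>2) = X\<^sup>2" and Y2: "(\<Sum>j\<in>J. (y j)\<^sup>2) = Y\<^sup>2"
    by (simp_all add: X_def Y_def L2_set_def sum_nonneg)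
  define a where "a = Y / (2 * X)"
  define b where "b = X / (2 * Y)"
  have ab: "0 < a" "0 < b" using pos by (simp_all add: a_def b_def)
  have "x i * y j \<le> a * (x i)\<^sup>2 + b * (y j)\<^sup>2" for i j
  proof -
    have "0 \<le> (Y * x i - X * y j)\<^sup>2 / (2 * X * Y)"
      using pos by simp
    also have "\<dots> = a * (x i)\<^sup>2 + b * (y j)\<^sup>2 - x i * y j"
      using pos by (simp add: a_def b_def field_simps power2_eq_square)
    finally show ?thesis by simp
  qed
  then have am_gm: "ennreal (x i) * ennreal (y j) \<le> ennreal (a * (x i)\<^sup>2) + ennreal (b * (y j)\<^sup>2)"
    for i j
    using nonneg ab by (simp add: ennreal_mult[symmetric] ennreal_plus[symmetric] ennreal_leI
        del: ennreal_plus)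
  have "(\<Sum>i\<in>I. \<Sum>j\<in>J. ennreal (x i) * k i j * ennreal (y j))
      \<le> (\<Sum>i\<in>I. \<Sum>j\<in>J. ennreal (a * (x i)\<^sup>2) * k i j + ennreal (b * (y j)\<^sup>2) * k i j)"
  proof (intro sum_mono)
    fix i j
    have "ennreal (x i) * k i j * ennreal (y j) = (ennreal (x i) * ennreal (y j)) * k i j"
      by (simp add: ac_simps)
    also have "\<dots> \<le> (ennreal (a * (x i)\<^sup>2) + ennreal (b * (y j)\<^sup>2)) * k i j"
      by (intro mult_right_mono am_gm) auto
    finally show "ennreal (x i) * k i j * ennreal (y j)
        \<le> ennreal (a * (x i)\<^sup>2) * k i j + ennreal (b * (y j)\<^sup>2) * k i j"
      by (simp add: distrib_right)
  qed
  also have "\<dots> = (\<Sum>i\<in>I. ennreal (a * (x i)\<^sup>2) * (\<Sum>j\<in>J. k i j))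
      + (\<Sum>j\<in>J. ennreal (b * (y j)\<^sup>2) * (\<Sum>i\<in>I. k i j))"
    unfolding sum_distrib_left sum.distrib by (rule arg_cong[OF sum.swap])
  also have "\<dots> \<le> (\<Sum>i\<in>I. ennreal (a * (x i)\<^sup>2) * E) + (\<Sum>j\<in>J. ennreal (b * (y j)\<^sup>2) * E)"
    by (intro add_mono sum_mono mult_left_mono rows cols) auto
  also have "\<dots> = ennreal (a * X\<^sup>2 + b * Y\<^sup>2) * E"
    using ab by (simp add: sum_distrib_right[symmetric] sum_ennreal sum_distrib_left[symmetric]
        X2 Y2 distrib_right)
  also have "a * X\<^sup>2 + b * Y\<^sup>2 = X * Y"
    using pos by (simp add: a_def b_def field_simps power2_eq_square)
  finally show ?thesis
    by (simp add: X_def Y_def mult.commute)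
qed

text \<open>
  Counting points in intervals of length \<open>1\<close> is all that is needed of a separated set; it
  gives uniform bounds for the fibres of \<open>\<gamma> \<mapsto> \<lfloor>x - \<gamma>\<rfloor>\<close>.
\<close>

locale relatively_separated =
  fixes \<Gamma> :: "real set" and K :: nat
  assumes finite_Icc: "finite (\<Gamma> \<inter> {t..t + 1})"
    and card_Icc: "card (\<Gamma> \<inter> {t..t + 1}) \<le> K"
begin

lemma finite_bounded: "finite (\<Gamma> \<inter> {a..b})"
proof (rule finite_subset)
  show "\<Gamma> \<inter> {a..b} \<subseteq> (\<Union>k\<in>{\<lfloor>a\<rfloor>..\<lfloor>b\<rfloor>}. \<Gamma> \<inter> {real_of_int k..real_of_int k + 1})"
  proof
    fix \<gamma> assume "\<gamma> \<in> \<Gamma> \<inter> {a..b}"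
    then show "\<gamma> \<in> (\<Union>k\<in>{\<lfloor>a\<rfloor>..\<lfloor>b\<rfloor>}. \<Gamma> \<inter> {real_of_int k..real_of_int k + 1})"
      by (intro UN_I[of "\<lfloor>\<gamma>\<rfloor>"]) (auto simp: floor_mono less_imp_le)
  qed
  show "finite (\<Union>k\<in>{\<lfloor>a\<rfloor>..\<lfloor>b\<rfloor>}. \<Gamma> \<inter> {real_of_int k..real_of_int k + 1})"
    by (intro finite_UN_I finite_Icc) simp
qed

lemma countable: "countable \<Gamma>"
proof -
  have "\<Gamma> = (\<Union>n::nat. \<Gamma> \<inter> {- real n..real n})"
  proof (rule antisym; rule subsetI)
    fix \<gamma> assume "\<gamma> \<in> \<Gamma>"
    moreover obtain n :: nat where "\<bar>\<gamma>\<bar> \<le> real n"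
      using real_arch_simple by blast
    ultimately show "\<gamma> \<in> (\<Union>n::nat. \<Gamma> \<inter> {- real n..real n})"
      by (intro UN_I[of n]) auto
  qed auto
  moreover have "countable (\<Union>n::nat. \<Gamma> \<inter> {- real n..real n})"
    by (rule countable_UN) (auto intro: countable_finite finite_bounded)
  ultimately show ?thesis
    by simp
qed

lemma sigma_finite_lborel_count: "pair_sigma_finite lborel (count_space \<Gamma>)"
  by (intro pair_sigma_finite.intro sigma_finite_measure_count_space_countable countable sigma_finite_lborel)

lemma sigma_finite_count_lborel: "pair_sigma_finite (count_space \<Gamma>) lborel"
  by (intro pair_sigma_finite.intro sigma_finite_measure_count_space_countable countable sigma_finite_lborel)

lemma fibres_floor:
  "finite {\<gamma> \<in> \<Gamma>. \<lfloor>x - \<gamma>\<rfloor> = k} \<and> card {\<gamma> \<in> \<Gamma>. \<lfloor>x - \<gamma>\<rfloor> = k} \<le> K" (is ?thesis1)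
  "finite {\<gamma> \<in> \<Gamma>. \<lfloor>\<gamma> - x\<rfloor> = k} \<and> card {\<gamma> \<in> \<Gamma>. \<lfloor>\<gamma> - x\<rfloor> = k} \<le> K" (is ?thesis2)
proof -
  have *: "finite A \<and> card A \<le> K" if "A \<subseteq> \<Gamma> \<inter> {t..t + 1}" for A t
    using card_mono[OF finite_Icc that] card_Icc[of t] finite_subset[OF that finite_Icc] by simp
  show ?thesis1
    by (rule *[of _ "x - k - 1"]) (auto simp: floor_eq_iff)
  show ?thesis2
    by (rule *[of _ "x + k"]) (auto simp: floor_eq_iff)
qed

lemma nn_integral_floor_diff_le:
  fixes h :: "int \<Rightarrow> ennreal"
  shows "(\<integral>\<^sup>+\<gamma>. h \<lfloor>x - \<gamma>\<rfloor> \<partial>count_space \<Gamma>) \<le> of_nat K * (\<integral>\<^sup>+k. h k \<partial>count_space UNIV)"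
    and "(\<integral>\<^sup>+\<gamma>. h \<lfloor>\<gamma> - x\<rfloor> \<partial>count_space \<Gamma>) \<le> of_nat K * (\<integral>\<^sup>+k. h k \<partial>count_space UNIV)"
  using nn_integral_fibres_le[OF countable, of UNIV "\<lambda>\<gamma>. \<lfloor>x - \<gamma>\<rfloor>" K h]
    nn_integral_fibres_le[OF countable, of UNIV "\<lambda>\<gamma>. \<lfloor>\<gamma> - x\<rfloor>" K h] fibres_floor
  by auto

end

text \<open>
  Points at mutual distance at least \<open>e\<close> fall into different cells of a grid of mesh \<open>e\<close>.
\<close>

lemma uniform_discrete_imp_relatively_separated:
  assumes "uniform_discrete \<Gamma>"
  shows "\<exists>K. relatively_separated \<Gamma> K"
proof -
  obtain e where e: "0 < e" "\<And>x y. x \<in> \<Gamma> \<Longrightarrow> y \<in> \<Gamma> \<Longrightarrow> dist x y < e \<Longrightarrow> x = y"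
    using assms unfolding uniform_discrete_def by blast
  define m where "m = \<lfloor>1 / e\<rfloor> + 1"
  have "finite (\<Gamma> \<inter> {t..t + 1}) \<and> card (\<Gamma> \<inter> {t..t + 1}) \<le> card {0..m}" for t
  proof -
    let ?s = "\<lambda>x. \<lfloor>(x - t) / e\<rfloor>"
    have inj: "inj_on ?s (\<Gamma> \<inter> {t..t + 1})"
    proof (rule inj_onI)
      fix x y assume x: "x \<in> \<Gamma> \<inter> {t..t + 1}" and y: "y \<in> \<Gamma> \<inter> {t..t + 1}" and eq: "?s x = ?s y"
      have "\<bar>(x - t) / e - (y - t) / e\<bar> < 1"
        using eq by linarith
      moreover have "(x - t) / e - (y - t) / e = (x - y) / e"
        by (simp add: diff_divide_distrib)
      ultimately have "dist x y < e"
        using e(1) by (simp add: dist_real_def abs_divide)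
      with e(2) x y show "x = y" by blast
    qed
    have "?s ` (\<Gamma> \<inter> {t..t + 1}) \<subseteq> {0..m}"
    proof
      fix k assume "k \<in> ?s ` (\<Gamma> \<inter> {t..t + 1})"
      then obtain x where x: "t \<le> x" "x \<le> t + 1" "k = ?s x" by auto
      have "0 \<le> (x - t) / e" "(x - t) / e \<le> 1 / e"
        using x e(1) by (auto simp: divide_right_mono)
      then show "k \<in> {0..m}"
        using x(3) floor_mono[of "(x - t) / e" "1 / e"] by (auto simp: m_def)
    qed
    then show ?thesis
      using inj_on_finite[OF inj, of "{0..m}"] card_inj_on_le[OF inj, of "{0..m}"] by auto
  qed
  then show ?thesis
    by (auto simp: relatively_separated_def)
qed

section \<open>The synthesis and analysis operators\<close>

text \<open>
  The generator is dominated everywhere by a step function with summable values \<open>g k\<close>, so that no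
  exceptional null sets occur.  A function in the amalgam space has this property after a change
  on a null set (lemma \<open>amalgam_representative\<close>).
\<close>

locale amalgam_generator = relatively_separated \<Gamma> K for \<Gamma> :: "real set" and K :: nat +
  fixes G :: "real \<Rightarrow> complex" and g :: "int \<Rightarrow> ennreal"
  assumes G_measurable [measurable]: "G \<in> borel_measurable borel"
    and norm_G_le: "ennreal (norm (G x)) \<le> g \<lfloor>x\<rfloor>"
    and g_summable: "(\<integral>\<^sup>+k. g k \<partial>count_space UNIV) < top"
begin

text \<open>
  The summands \<open>1\<close> make one positive constant that dominates the row and the column sums of
  the kernel \<open>g \<lfloor>x - \<gamma>\<rfloor>\<close> at the same time.
\<close>

definition schur_const :: real where
  "schur_const = (1 + real K) * (1 + enn2real (\<integral>\<^sup>+k. g k \<partial>count_space UNIV))"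

lemma schur_const_pos: "0 < schur_const"
  by (auto simp: schur_const_def intro!: mult_pos_pos add_pos_nonneg)

lemma sum_g_le_schur_const:
  "(\<integral>\<^sup>+k. g k \<partial>count_space UNIV) \<le> ennreal schur_const"
  "of_nat K * (\<integral>\<^sup>+k. g k \<partial>count_space UNIV) \<le> ennreal schur_const"
proof -
  obtain s where s: "(\<integral>\<^sup>+k. g k \<partial>count_space UNIV) = ennreal s" "0 \<le> s"
    using g_summable by (cases "\<integral>\<^sup>+k. g k \<partial>count_space UNIV") auto
  have expand: "schur_const = 1 + s + K + K * s"
    using s by (simp add: schur_const_def algebra_simps)
  show "(\<integral>\<^sup>+k. g k \<partial>count_space UNIV) \<le> ennreal schur_const"
    unfolding s expand using s by (intro ennreal_leI) simp
  have "of_nat K * ennreal s = ennreal (K * s)"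
    using s by (simp add: ennreal_mult ennreal_of_nat_eq_real_of_nat)
  also have "\<dots> \<le> ennreal schur_const"
    unfolding expand using s by (intro ennreal_leI) simp
  finally show "of_nat K * (\<integral>\<^sup>+k. g k \<partial>count_space UNIV) \<le> ennreal schur_const"
    unfolding s .
qed

lemma g_floor_rows: "(\<integral>\<^sup>+\<gamma>. g \<lfloor>x - \<gamma>\<rfloor> \<partial>count_space \<Gamma>) \<le> ennreal schur_const"
  using nn_integral_floor_diff_le(1)[of g x] sum_g_le_schur_const(2) by (rule order_trans)

lemma g_floor_cols:
  fixes \<gamma> :: real
  shows "(\<integral>\<^sup>+x. g \<lfloor>x - \<gamma>\<rfloor> \<partial>lborel) \<le> ennreal schur_const"
  using nn_integral_lborel_translate[of "\<lambda>x. g \<lfloor>x\<rfloor>" \<gamma>] nn_integral_floor[of g] sum_g_le_schur_const(1)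
  by simp

text \<open>
  A Bochner integral over counting measure; it agrees with the defining series for bounded
  coefficients (lemma \<open>shift_series_eq_synth\<close>), and it comes with measurability in \<open>x\<close> and linearity.
\<close>

definition synth :: "(real \<Rightarrow> complex) \<Rightarrow> real \<Rightarrow> complex" where
  "synth c x = (LINT \<gamma>|count_space \<Gamma>. c \<gamma> * G (x - \<gamma>))"

definition analysis :: "(real \<Rightarrow> complex) \<Rightarrow> real \<Rightarrow> complex" where
  "analysis f \<gamma> = (LINT x|lborel. cnj (G (x - \<gamma>)) * f x)"

lemma norm_synth_le:
  "ennreal (norm (synth c x)) \<le> (\<integral>\<^sup>+\<gamma>. g \<lfloor>x - \<gamma>\<rfloor> * ennreal (norm (c \<gamma>)) \<partial>count_space \<Gamma>)"
proof -
  have "ennreal (norm (synth c x)) \<le> (\<integral>\<^sup>+\<gamma>. ennreal (norm (c \<gamma> * G (x - \<gamma>))) \<partial>count_space \<Gamma>)"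
    unfolding synth_def by (rule norm_lebesgue_integral_le)
  also have "\<dots> \<le> (\<integral>\<^sup>+\<gamma>. g \<lfloor>x - \<gamma>\<rfloor> * ennreal (norm (c \<gamma>)) \<partial>count_space \<Gamma>)"
    by (intro nn_integral_mono)
      (simp add: norm_mult ennreal_mult mult.commute[of "g _"] mult_left_mono norm_G_le)
  finally show ?thesis .
qed

lemma norm_analysis_le:
  "ennreal (norm (analysis f \<gamma>)) \<le> (\<integral>\<^sup>+x. g \<lfloor>x - \<gamma>\<rfloor> * ennreal (norm (f x)) \<partial>lborel)"
proof -
  have "ennreal (norm (analysis f \<gamma>)) \<le> (\<integral>\<^sup>+x. ennreal (norm (cnj (G (x - \<gamma>)) * f x)) \<partial>lborel)"
    unfolding analysis_def by (rule norm_lebesgue_integral_le)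
  also have "\<dots> \<le> (\<integral>\<^sup>+x. g \<lfloor>x - \<gamma>\<rfloor> * ennreal (norm (f x)) \<partial>lborel)"
    by (intro nn_integral_mono) (simp add: norm_mult ennreal_mult mult_right_mono norm_G_le)
  finally show ?thesis .
qed

lemma synth_measurable [measurable]: "synth c \<in> borel_measurable borel"
proof -
  interpret sigma_finite_measure "count_space \<Gamma>"
    by (intro sigma_finite_measure_count_space_countable countable)
  have "(\<lambda>(x, \<gamma>). c \<gamma> * G (x - \<gamma>)) \<in> borel_measurable (borel \<Otimes>\<^sub>M count_space \<Gamma>)"
  proof -
    have "(\<lambda>(\<gamma>, x). c \<gamma> * G (x - \<gamma>)) \<in> borel_measurable (count_space \<Gamma> \<Otimes>\<^sub>M borel)"
      by (intro measurable_pair_measure_countable1 countable) simp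
    then show ?thesis
      by (subst measurable_pair_swap_iff) (simp add: case_prod_unfold)
  qed
  then show ?thesis
    unfolding synth_def[abs_def] by (rule borel_measurable_lebesgue_integral)
qed

lemma kernel_measurable:
  "(\<lambda>(x, \<gamma>). g \<lfloor>x - \<gamma>\<rfloor>) \<in> borel_measurable (lborel \<Otimes>\<^sub>M count_space \<Gamma>)"
  "(\<lambda>(\<gamma>, x). g \<lfloor>x - \<gamma>\<rfloor>) \<in> borel_measurable (count_space \<Gamma> \<Otimes>\<^sub>M lborel)"
proof -
  show "(\<lambda>(x, \<gamma>). g \<lfloor>x - \<gamma>\<rfloor>) \<in> borel_measurable (lborel \<Otimes>\<^sub>M count_space \<Gamma>)"
    by (intro measurable_pair_count_space countable) simp
  show "(\<lambda>(\<gamma>, x). g \<lfloor>x - \<gamma>\<rfloor>) \<in> borel_measurable (count_space \<Gamma> \<Otimes>\<^sub>M lborel)"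
    by (intro measurable_pair_measure_countable1 countable) simp
qed

text \<open>
  The upper stability bound, and the same bound for the adjoint operator: both operators are
  dominated by the kernel \<open>g \<lfloor>x - \<gamma>\<rfloor>\<close>.
\<close>

lemma nn_Lp_synth_le:
  assumes "1 \<le> p"
  shows "nn_Lp p lborel (\<lambda>x. ennreal (norm (synth c x)))
    \<le> ennreal schur_const * nn_Lp p (count_space \<Gamma>) (\<lambda>\<gamma>. ennreal (norm (c \<gamma>)))"
  by (rule Schur_test[OF sigma_finite_lborel_count kernel_measurable(1)])
    (use assms schur_const_pos g_floor_rows g_floor_cols norm_synth_le in auto)

lemma nn_Lp_analysis_le:
  assumes "1 \<le> p" and [measurable]: "f \<in> borel_measurable borel"
  shows "nn_Lp p (count_space \<Gamma>) (\<lambda>\<gamma>. ennreal (norm (analysis f \<gamma>)))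
    \<le> ennreal schur_const * nn_Lp p lborel (\<lambda>x. ennreal (norm (f x)))"
  by (rule Schur_test[OF sigma_finite_count_lborel kernel_measurable(2)])
    (use assms schur_const_pos g_floor_rows g_floor_cols norm_analysis_le in auto)

lemma synth_le:
  assumes "\<And>\<gamma>. \<gamma> \<in> \<Gamma> \<Longrightarrow> norm (c \<gamma>) \<le> B" "0 \<le> B"
  shows "norm (synth c x) \<le> schur_const * B"
    and "integrable (count_space \<Gamma>) (\<lambda>\<gamma>. c \<gamma> * G (x - \<gamma>))"
proof -
  have *: "(\<integral>\<^sup>+\<gamma>. g \<lfloor>x - \<gamma>\<rfloor> * ennreal (norm (c \<gamma>)) \<partial>count_space \<Gamma>) \<le> ennreal (schur_const * B)"
  proof -
    have "(\<integral>\<^sup>+\<gamma>. g \<lfloor>x - \<gamma>\<rfloor> * ennreal (norm (c \<gamma>)) \<partial>count_space \<Gamma>)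
        \<le> (\<integral>\<^sup>+\<gamma>. g \<lfloor>x - \<gamma>\<rfloor> * ennreal B \<partial>count_space \<Gamma>)"
      using assms by (intro nn_integral_mono mult_left_mono ennreal_leI) auto
    also have "\<dots> = (\<integral>\<^sup>+\<gamma>. g \<lfloor>x - \<gamma>\<rfloor> \<partial>count_space \<Gamma>) * ennreal B"
      by (rule nn_integral_multc) simp
    also have "\<dots> \<le> ennreal schur_const * ennreal B"
      by (intro mult_right_mono g_floor_rows) simp
    finally show ?thesis
      using schur_const_pos assms by (simp add: ennreal_mult)
  qed
  have "ennreal (norm (synth c x)) \<le> ennreal (schur_const * B)"
    using norm_synth_le * by (rule order_trans)
  then show "norm (synth c x) \<le> schur_const * B"
    using schur_const_pos assms by (subst (asm) ennreal_le_iff) auto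
  have "(\<integral>\<^sup>+\<gamma>. ennreal (norm (c \<gamma> * G (x - \<gamma>))) \<partial>count_space \<Gamma>)
      \<le> (\<integral>\<^sup>+\<gamma>. g \<lfloor>x - \<gamma>\<rfloor> * ennreal (norm (c \<gamma>)) \<partial>count_space \<Gamma>)"
    by (intro nn_integral_mono)
      (simp add: norm_mult ennreal_mult mult.commute[of "g _"] mult_left_mono norm_G_le)
  also note *
  also have "ennreal (schur_const * B) < \<infinity>"
    by simp
  finally show "integrable (count_space \<Gamma>) (\<lambda>\<gamma>. c \<gamma> * G (x - \<gamma>))"
    by (intro integrableI_bounded) simp_all
qed

lemma shift_series_eq_synth:
  assumes "\<And>\<gamma>. \<gamma> \<in> \<Gamma> \<Longrightarrow> norm (c \<gamma>) \<le> B" "0 \<le> B"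
  shows "shift_series \<Gamma> G c x = synth c x"
  unfolding shift_series_def synth_def
  by (intro infsum_eq_lebesgue_integral_count_space synth_le(2)[OF assms])

lemma integrable_translate_G: "integrable lborel (\<lambda>x. G (x - \<gamma>))"
proof (rule integrableI_bounded)
  have "(\<integral>\<^sup>+x. ennreal (norm (G (x - \<gamma>))) \<partial>lborel) \<le> (\<integral>\<^sup>+x. g \<lfloor>x - \<gamma>\<rfloor> \<partial>lborel)"
    by (intro nn_integral_mono norm_G_le)
  also note g_floor_cols
  also have "ennreal schur_const < \<infinity>"
    by simp
  finally show "(\<integral>\<^sup>+x. ennreal (norm (G (x - \<gamma>))) \<partial>lborel) < \<infinity>" .
qed simp

lemma integrable_pairing:
  assumes "\<And>x. norm (f x) \<le> B" and [measurable]: "f \<in> borel_measurable borel"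
  shows "integrable lborel (\<lambda>x. cnj (G (x - \<gamma>)) * f x)"
proof (rule Bochner_Integration.integrable_bound)
  show "integrable lborel (\<lambda>x. complex_of_real B * G (x - \<gamma>))"
    by (intro integrable_mult_right integrable_translate_G)
  have "0 \<le> B"
    using assms(1)[of 0] norm_ge_zero order_trans by blast
  then have "norm (cnj (G (x - \<gamma>)) * f x) \<le> norm (complex_of_real B * G (x - \<gamma>))" for x
    using mult_left_mono[OF assms(1)[of x], of "norm (G (x - \<gamma>))"]
    by (simp add: norm_mult mult.commute)
  then show "AE x in lborel. norm (cnj (G (x - \<gamma>)) * f x) \<le> norm (complex_of_real B * G (x - \<gamma>))"
    by simp
  have [measurable]: "(cnj :: complex \<Rightarrow> complex) \<in> borel_measurable borel"
    by (intro borel_measurable_continuous_onI continuous_intros)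
  show "(\<lambda>x. cnj (G (x - \<gamma>)) * f x) \<in> borel_measurable lborel"
    by measurable
qed

text \<open>
  A bound for the entries of the Gram matrix at points \<open>\<gamma>\<close>, \<open>\<gamma>'\<close> with \<open>\<lfloor>\<gamma> - \<gamma>'\<rfloor> = j\<close>.  It has two terms
  because \<open>\<lfloor>x - \<gamma>'\<rfloor>\<close> is \<open>\<lfloor>x - \<gamma>\<rfloor> + j\<close> or \<open>\<lfloor>x - \<gamma>\<rfloor> + j + 1\<close>.
\<close>

definition gram_bound :: "int \<Rightarrow> ennreal" where
  "gram_bound j = (\<integral>\<^sup>+i. g i * (g (i + j) + g (i + j + 1)) \<partial>count_space UNIV)"

lemma gram_bound_summable: "(\<integral>\<^sup>+j. gram_bound j \<partial>count_space UNIV) < top"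
proof -
  let ?s = "\<integral>\<^sup>+k. g k \<partial>count_space UNIV"
  have shift: "(\<integral>\<^sup>+j. g (i + j) \<partial>count_space UNIV) = ?s"
    "(\<integral>\<^sup>+j. g (i + j + 1) \<partial>count_space UNIV) = ?s" for i
    using nn_integral_count_space_int_shift[of g i] nn_integral_count_space_int_shift[of g "i + 1"]
    by (simp_all add: ac_simps)
  have "(\<integral>\<^sup>+j. gram_bound j \<partial>count_space UNIV)
      = (\<integral>\<^sup>+i. \<integral>\<^sup>+j. g i * (g (i + j) + g (i + j + 1)) \<partial>count_space UNIV \<partial>count_space UNIV)"
    unfolding gram_bound_def by (rule nn_integral_swap_count_space) simp_all
  also have "\<dots> = (\<integral>\<^sup>+i. g i * (?s + ?s) \<partial>count_space UNIV)"
    by (simp add: nn_integral_cmult nn_integral_add shift)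
  also have "\<dots> = ?s * (?s + ?s)"
    by (rule nn_integral_multc) simp
  also have "\<dots> < top"
    using g_summable by (simp add: ennreal_mult_less_top)
  finally show ?thesis .
qed

lemma gram_le:
  fixes \<gamma> \<gamma>' :: real
  shows "(\<integral>\<^sup>+x. g \<lfloor>x - \<gamma>\<rfloor> * g \<lfloor>x - \<gamma>'\<rfloor> \<partial>lborel) \<le> gram_bound \<lfloor>\<gamma> - \<gamma>'\<rfloor>"
proof -
  let ?j = "\<lfloor>\<gamma> - \<gamma>'\<rfloor>"
  have "(\<integral>\<^sup>+x. g \<lfloor>x - \<gamma>\<rfloor> * g \<lfloor>x - \<gamma>'\<rfloor> \<partial>lborel)
      \<le> (\<integral>\<^sup>+x. g \<lfloor>x - \<gamma>\<rfloor> * (g (\<lfloor>x - \<gamma>\<rfloor> + ?j) + g (\<lfloor>x - \<gamma>\<rfloor> + ?j + 1)) \<partial>lborel)"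
  proof (intro nn_integral_mono mult_left_mono)
    fix x :: real
    have "\<lfloor>x - \<gamma>\<rfloor> + ?j \<le> \<lfloor>x - \<gamma>'\<rfloor>" "\<lfloor>x - \<gamma>'\<rfloor> \<le> \<lfloor>x - \<gamma>\<rfloor> + ?j + 1"
      by linarith+
    then have "\<lfloor>x - \<gamma>'\<rfloor> = \<lfloor>x - \<gamma>\<rfloor> + ?j \<or> \<lfloor>x - \<gamma>'\<rfloor> = \<lfloor>x - \<gamma>\<rfloor> + ?j + 1"
      by linarith
    then show "g \<lfloor>x - \<gamma>'\<rfloor> \<le> g (\<lfloor>x - \<gamma>\<rfloor> + ?j) + g (\<lfloor>x - \<gamma>\<rfloor> + ?j + 1)"
      by auto
  qed simp
  also have "\<dots> = (\<integral>\<^sup>+x. g \<lfloor>x :: real\<rfloor> * (g (\<lfloor>x\<rfloor> + ?j) + g (\<lfloor>x\<rfloor> + ?j + 1)) \<partial>lborel)"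
    by (rule nn_integral_lborel_translate[of "\<lambda>x. g \<lfloor>x\<rfloor> * (g (\<lfloor>x\<rfloor> + ?j) + g (\<lfloor>x\<rfloor> + ?j + 1))"]) simp
  also have "\<dots> = gram_bound ?j"
    unfolding gram_bound_def by (rule nn_integral_floor)
  finally show ?thesis .
qed

text \<open>
  The composition of analysis and synthesis is the Gram matrix.  Its action is estimated by
  inserting the pointwise bounds for both operators and exchanging sum and integral by Tonelli's
  theorem.
\<close>

lemma norm_analysis_synth_le:
  "ennreal (norm (analysis (synth e) \<gamma>))
    \<le> (\<integral>\<^sup>+\<gamma>'. gram_bound \<lfloor>\<gamma> - \<gamma>'\<rfloor> * ennreal (norm (e \<gamma>')) \<partial>count_space \<Gamma>)"
proof -
  interpret pair_sigma_finite lborel "count_space \<Gamma>"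
    by (rule sigma_finite_lborel_count)
  have "ennreal (norm (analysis (synth e) \<gamma>))
      \<le> (\<integral>\<^sup>+x. g \<lfloor>x - \<gamma>\<rfloor> * ennreal (norm (synth e x)) \<partial>lborel)"
    by (rule norm_analysis_le)
  also have "\<dots> \<le> (\<integral>\<^sup>+x. g \<lfloor>x - \<gamma>\<rfloor>
      * (\<integral>\<^sup>+\<gamma>'. g \<lfloor>x - \<gamma>'\<rfloor> * ennreal (norm (e \<gamma>')) \<partial>count_space \<Gamma>) \<partial>lborel)"
    by (intro nn_integral_mono mult_left_mono norm_synth_le) simp
  also have "\<dots> = (\<integral>\<^sup>+x. \<integral>\<^sup>+\<gamma>'. g \<lfloor>x - \<gamma>\<rfloor> * (g \<lfloor>x - \<gamma>'\<rfloor> * ennreal (norm (e \<gamma>')))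
      \<partial>count_space \<Gamma> \<partial>lborel)"
    by (simp add: nn_integral_cmult)
  also have "\<dots> = (\<integral>\<^sup>+\<gamma>'. \<integral>\<^sup>+x. g \<lfloor>x - \<gamma>\<rfloor> * (g \<lfloor>x - \<gamma>'\<rfloor> * ennreal (norm (e \<gamma>')))
      \<partial>lborel \<partial>count_space \<Gamma>)"
    by (rule Fubini'[symmetric]) (intro measurable_pair_count_space countable, simp)
  also have "\<dots> = (\<integral>\<^sup>+\<gamma>'. (\<integral>\<^sup>+x. g \<lfloor>x - \<gamma>\<rfloor> * g \<lfloor>x - \<gamma>'\<rfloor> \<partial>lborel) * ennreal (norm (e \<gamma>'))
      \<partial>count_space \<Gamma>)"
    by (simp add: nn_integral_multc mult.assoc[symmetric])
  also have "\<dots> \<le> (\<integral>\<^sup>+\<gamma>'. gram_bound \<lfloor>\<gamma> - \<gamma>'\<rfloor> * ennreal (norm (e \<gamma>')) \<partial>count_space \<Gamma>)"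
    by (intro nn_integral_mono mult_right_mono gram_le) simp
  finally show ?thesis .
qed

text \<open>
  At the point \<open>\<gamma>\<close>, the commutator of the Gram matrix with multiplication by \<open>\<psi>\<close> equals the Gram
  matrix applied to the sequence \<open>(\<psi> \<gamma>' - \<psi> \<gamma>) * c \<gamma>'\<close>.
\<close>

lemma norm_commutator_le:
  fixes \<psi> :: "real \<Rightarrow> real" and c :: "real \<Rightarrow> complex"
  assumes c: "\<And>\<gamma>. \<gamma> \<in> \<Gamma> \<Longrightarrow> norm (c \<gamma>) \<le> B" and B: "0 \<le> B"
    and \<psi>: "\<And>t. 0 \<le> \<psi> t" "\<And>t. \<psi> t \<le> 1"
  shows "ennreal (norm (analysis (synth (\<lambda>t. \<psi> t * c t)) \<gamma> - \<psi> \<gamma> * analysis (synth c) \<gamma>))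
    \<le> (\<integral>\<^sup>+\<gamma>'. gram_bound \<lfloor>\<gamma> - \<gamma>'\<rfloor> * (ennreal \<bar>\<psi> \<gamma>' - \<psi> \<gamma>\<bar> * ennreal (norm (c \<gamma>'))) \<partial>count_space \<Gamma>)"
proof -
  let ?b = "\<lambda>t. complex_of_real (\<psi> t) * c t"
  have b: "norm (?b t) \<le> B" if "t \<in> \<Gamma>" for t
    using mult_mono[of "\<psi> t" 1 "norm (c t)" B] c[OF that] \<psi>[of t] by (simp add: norm_mult)
  define e where "e = (\<lambda>t. complex_of_real (\<psi> t - \<psi> \<gamma>) * c t)"
  have synth_e: "synth e x = synth ?b x - \<psi> \<gamma> * synth c x" for x
  proof -
    have "synth ?b x - \<psi> \<gamma> * synth c x
        = (LINT t|count_space \<Gamma>. ?b t * G (x - t) - \<psi> \<gamma> * (c t * G (x - t)))"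
      unfolding synth_def
      using synth_le(2)[OF b B] synth_le(2)[OF c B]
      by (subst Bochner_Integration.integral_diff) auto
    also have "\<dots> = synth e x"
      unfolding synth_def e_def by (intro Bochner_Integration.integral_cong) (auto simp: algebra_simps)
    finally show ?thesis ..
  qed
  have "analysis (synth ?b) \<gamma> - \<psi> \<gamma> * analysis (synth c) \<gamma>
      = (LINT x|lborel. cnj (G (x - \<gamma>)) * synth ?b x - \<psi> \<gamma> * (cnj (G (x - \<gamma>)) * synth c x))"
    unfolding analysis_def
    using integrable_pairing[OF synth_le(1)[OF b B]] integrable_pairing[OF synth_le(1)[OF c B]]
    by (subst Bochner_Integration.integral_diff) auto
  also have "\<dots> = analysis (synth e) \<gamma>"
    unfolding analysis_def
    by (intro Bochner_Integration.integral_cong) (auto simp: synth_e algebra_simps)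
  finally have "ennreal (norm (analysis (synth ?b) \<gamma> - \<psi> \<gamma> * analysis (synth c) \<gamma>))
      \<le> (\<integral>\<^sup>+\<gamma>'. gram_bound \<lfloor>\<gamma> - \<gamma>'\<rfloor> * ennreal (norm (e \<gamma>')) \<partial>count_space \<Gamma>)"
    using norm_analysis_synth_le[of e \<gamma>] by simp
  then show ?thesis
    by (simp add: e_def norm_mult ennreal_mult del: of_real_diff)
qed

text \<open>
  For finitely supported \<open>b\<close>, \<open>\<parallel>T b\<parallel>\<^sup>2 = \<langle>T\<^sup>* T b, b\<rangle>\<close>.  Through this identity the \<open>l\<^sup>2\<close> bound for \<open>T\<close>
  becomes a bound in terms of the Gram matrix.
\<close>

lemma energy_le:
  fixes b :: "real \<Rightarrow> complex"
  assumes S: "finite S" "S \<subseteq> \<Gamma>" and b: "\<And>\<gamma>. \<gamma> \<in> \<Gamma> \<Longrightarrow> \<gamma> \<notin> S \<Longrightarrow> b \<gamma> = 0"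
  shows "(\<integral>\<^sup>+x. ennreal ((norm (synth b x))\<^sup>2) \<partial>lborel)
    \<le> (\<Sum>\<gamma>\<in>S. ennreal (norm (b \<gamma>)) * ennreal (norm (analysis (synth b) \<gamma>)))"
proof -
  define B where "B = (\<Sum>\<gamma>\<in>S. norm (b \<gamma>))"
  have B0: "0 \<le> B"
    unfolding B_def by (intro sum_nonneg) simp
  have B: "norm (b \<gamma>) \<le> B" if "\<gamma> \<in> \<Gamma>" for \<gamma>
    using b[OF that] B0 member_le_sum[of \<gamma> S "\<lambda>\<gamma>. norm (b \<gamma>)"] S(1)
    by (cases "\<gamma> \<in> S") (auto simp: B_def)
  have synth_b: "synth b x = (\<Sum>\<gamma>\<in>S. b \<gamma> * G (x - \<gamma>))" for x
  proof -
    have "shift_series \<Gamma> G b x = (\<Sum>\<^sub>\<infinity>\<gamma>\<in>S. b \<gamma> * G (x - \<gamma>))"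
      unfolding shift_series_def using S b by (intro infsum_cong_neutral) auto
    then show ?thesis
      using S shift_series_eq_synth[OF B B0] by simp
  qed
  have int: "integrable lborel (\<lambda>x. cnj (G (x - \<gamma>)) * synth b x)" for \<gamma>
    by (rule integrable_pairing[OF synth_le(1)[OF B B0] synth_measurable])
  have square: "complex_of_real ((norm (synth b x))\<^sup>2)
      = (\<Sum>\<gamma>\<in>S. cnj (b \<gamma>) * (cnj (G (x - \<gamma>)) * synth b x))" for x
  proof -
    have "complex_of_real ((norm (synth b x))\<^sup>2) = cnj (synth b x) * synth b x"
      by (subst complex_norm_square) (rule mult.commute)
    also have "\<dots> = (\<Sum>\<gamma>\<in>S. cnj (b \<gamma>) * cnj (G (x - \<gamma>))) * synth b x"
      by (subst (1) synth_b) simp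
    finally show ?thesis
      by (simp add: sum_distrib_right mult.assoc)
  qed
  have int2: "integrable lborel (\<lambda>x. complex_of_real ((norm (synth b x))\<^sup>2))"
    unfolding square by (intro Bochner_Integration.integrable_sum integrable_mult_right int)
  then have int3: "integrable lborel (\<lambda>x. (norm (synth b x))\<^sup>2)"
    by (simp only: complex_of_real_integrable_eq)
  have "complex_of_real (LINT x|lborel. (norm (synth b x))\<^sup>2)
      = (LINT x|lborel. complex_of_real ((norm (synth b x))\<^sup>2))"
    by (rule integral_complex_of_real[symmetric])
  also have "\<dots> = (\<Sum>\<gamma>\<in>S. cnj (b \<gamma>) * analysis (synth b) \<gamma>)"
    unfolding square analysis_def
    by (subst Bochner_Integration.integral_sum) (auto intro: int)
  finally have "\<bar>LINT x|lborel. (norm (synth b x))\<^sup>2\<bar> = norm (\<Sum>\<gamma>\<in>S. cnj (b \<gamma>) * analysis (synth b) \<gamma>)"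
    by (metis norm_of_real)
  also have "\<dots> \<le> (\<Sum>\<gamma>\<in>S. norm (b \<gamma>) * norm (analysis (synth b) \<gamma>))"
    by (rule order_trans[OF norm_sum]) (simp add: norm_mult)
  finally have "ennreal (LINT x|lborel. (norm (synth b x))\<^sup>2)
      \<le> ennreal (\<Sum>\<gamma>\<in>S. norm (b \<gamma>) * norm (analysis (synth b) \<gamma>))"
    by (intro ennreal_leI) simp
  also have "\<dots> = (\<Sum>\<gamma>\<in>S. ennreal (norm (b \<gamma>)) * ennreal (norm (analysis (synth b) \<gamma>)))"
    by (simp add: sum_ennreal[symmetric] ennreal_mult)
  finally show ?thesis
    using nn_integral_eq_integral[OF int3] by simp
qed

section \<open>Localization to blocks\<close>

definition block :: "nat \<Rightarrow> int \<Rightarrow> real set" where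
  "block N m = {\<gamma> \<in> \<Gamma>. \<lfloor>\<gamma> / real N\<rfloor> = m}"

definition near_block :: "nat \<Rightarrow> int \<Rightarrow> real set" where
  "near_block N n = {\<gamma> \<in> \<Gamma>. \<lfloor>\<gamma> / real N\<rfloor> \<in> {n - 1..n + 1}}"

text \<open>
  A trapezoid centred at the midpoint of \<open>[n * N, (n + 1) * N]\<close>.
\<close>

definition cutoff :: "nat \<Rightarrow> int \<Rightarrow> real \<Rightarrow> real" where
  "cutoff N n t = max 0 (min 1 (3 / 2 - \<bar>t / real N - real_of_int n - 1 / 2\<bar>))"

lemma cutoff_bounds: "0 \<le> cutoff N n t" "cutoff N n t \<le> 1"
  by (auto simp: cutoff_def)

lemma cutoff_eq_1: "\<lfloor>t / real N\<rfloor> = n \<Longrightarrow> cutoff N n t = 1"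
  unfolding cutoff_def by linarith

lemma cutoff_eq_0: "\<lfloor>t / real N\<rfloor> \<notin> {n - 1..n + 1} \<Longrightarrow> cutoff N n t = 0"
  for t :: real
proof -
  assume "\<lfloor>t / real N\<rfloor> \<notin> {n - 1..n + 1}"
  then have "\<lfloor>t / real N\<rfloor> < n - 1 \<or> n + 2 \<le> \<lfloor>t / real N\<rfloor>"
    by auto
  then have "t / real N < real_of_int n - 1 \<or> real_of_int n + 2 \<le> t / real N"
    by linarith
  then have "3 / 2 - \<bar>t / real N - real_of_int n - 1 / 2\<bar> \<le> 0"
    by linarith
  then show ?thesis
    by (simp add: cutoff_def)
qed

lemma cutoff_lipschitz: "\<bar>cutoff N n s - cutoff N n t\<bar> \<le> min 1 (\<bar>t - s\<bar> / real N)"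
proof -
  have "\<bar>cutoff N n s - cutoff N n t\<bar> \<le> \<bar>t / real N - s / real N\<bar>"
    unfolding cutoff_def by linarith
  also have "\<dots> = \<bar>t - s\<bar> / real N"
    by (simp add: diff_divide_distrib[symmetric] abs_divide)
  finally show ?thesis
    using cutoff_bounds[of N n s] cutoff_bounds[of N n t] by auto
qed

lemma near_block_subset:
  assumes "0 < N"
  shows "near_block N n \<subseteq> \<Gamma> \<inter> {real_of_int (n - 1) * real N..real_of_int (n + 2) * real N}"
proof
  fix \<gamma> assume "\<gamma> \<in> near_block N n"
  then have \<gamma>: "\<gamma> \<in> \<Gamma>" "n - 1 \<le> \<lfloor>\<gamma> / real N\<rfloor>" "\<lfloor>\<gamma> / real N\<rfloor> \<le> n + 1"
    by (auto simp: near_block_def)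
  then have "real_of_int (n - 1) \<le> \<gamma> / real N" "\<gamma> / real N \<le> real_of_int (n + 2)"
    by linarith+
  with assms \<gamma>(1) show "\<gamma> \<in> \<Gamma> \<inter> {real_of_int (n - 1) * real N..real_of_int (n + 2) * real N}"
    by (simp add: field_simps)
qed

lemma finite_near_block: "0 < N \<Longrightarrow> finite (near_block N n)"
  using near_block_subset finite_bounded by (rule finite_subset)

lemma block_subset: "block N n \<subseteq> near_block N n"
  by (auto simp: block_def near_block_def)

lemma finite_block: "0 < N \<Longrightarrow> finite (block N n)"
  using block_subset finite_near_block by (rule finite_subset)

lemma near_block_rows:
  assumes "0 < N"
  shows "(\<integral>\<^sup>+\<gamma>. indicator (near_block N n) \<gamma> \<partial>count_space \<Gamma>) \<le> ennreal (real K * (3 * real N))"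
proof -
  let ?a = "real_of_int (n - 1) * real N"
  have "(\<integral>\<^sup>+\<gamma>. indicator (near_block N n) \<gamma> \<partial>count_space \<Gamma>)
      \<le> (\<integral>\<^sup>+\<gamma>. indicator {0..<3 * int N} \<lfloor>\<gamma> - ?a\<rfloor> \<partial>count_space \<Gamma>)"
  proof (intro nn_integral_mono)
    fix \<gamma>
    have "\<lfloor>\<gamma> - ?a\<rfloor> \<in> {0..<3 * int N}" if "\<gamma> \<in> near_block N n"
    proof -
      have \<gamma>: "n - 1 \<le> \<lfloor>\<gamma> / real N\<rfloor>" "\<lfloor>\<gamma> / real N\<rfloor> \<le> n + 1"
        using that by (auto simp: near_block_def)
      then have "real_of_int (n - 1) \<le> \<gamma> / real N" "\<gamma> / real N < real_of_int (n - 1) + 3"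
        by linarith+
      with assms have "?a \<le> \<gamma>" "\<gamma> < ?a + 3 * real N"
        by (simp_all add: field_simps)
      then show ?thesis
        by (auto simp: le_floor_iff floor_less_iff)
    qed
    then show "(indicator (near_block N n) \<gamma> :: ennreal) \<le> indicator {0..<3 * int N} \<lfloor>\<gamma> - ?a\<rfloor>"
      by (auto split: split_indicator)
  qed
  also have "\<dots> \<le> of_nat K * (\<integral>\<^sup>+k. indicator {0..<3 * int N} k \<partial>count_space UNIV)"
    by (rule nn_integral_floor_diff_le(2))
  also have "\<dots> = ennreal (real K * (3 * real N))"
    by (simp add: ennreal_mult ennreal_of_nat_eq_real_of_nat)
  finally show ?thesis .
qed

lemma near_block_cols:
  assumes "\<gamma> \<in> \<Gamma>"
  shows "(\<integral>\<^sup>+n. indicator (near_block N n) \<gamma> \<partial>count_space UNIV) = 3"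
proof -
  let ?k = "\<lfloor>\<gamma> / real N\<rfloor>"
  have "(\<integral>\<^sup>+n. indicator (near_block N n) \<gamma> \<partial>count_space UNIV)
      = (\<integral>\<^sup>+n. indicator {?k - 1..?k + 1} n \<partial>count_space UNIV)"
    using assms by (intro nn_integral_cong) (auto simp: near_block_def split: split_indicator)
  then show ?thesis
    by simp
qed

text \<open>
  The factor that damps \<^const>\<open>gram_bound\<close> bounds the increment of a cutoff between points
  \<open>\<gamma>\<close>, \<open>\<gamma>'\<close> with \<open>\<lfloor>\<gamma> - \<gamma>'\<rfloor> = j\<close>, whose distance is at most \<open>\<bar>j\<bar> + 1\<close>.
\<close>

definition commutator_bound :: "nat \<Rightarrow> int \<Rightarrow> ennreal" where
  "commutator_bound N j = gram_bound j * ennreal (min 1 ((real_of_int \<bar>j\<bar> + 1) / real N))"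

text \<open>
  Long blocks make the commutators small.  Summability of the Gram matrix off the diagonal is
  enough, without any rate, because the limit is taken under the sum.
\<close>

lemma commutator_bound_tendsto_0: "(\<lambda>N. \<integral>\<^sup>+j. commutator_bound N j \<partial>count_space UNIV) \<longlonglongrightarrow> 0"
proof -
  have "(\<lambda>N. \<integral>\<^sup>+j. commutator_bound N j \<partial>count_space UNIV) \<longlonglongrightarrow> (\<integral>\<^sup>+j. 0 \<partial>count_space (UNIV :: int set))"
  proof (rule nn_integral_dominated_convergence[where w = gram_bound])
    show "AE j in count_space UNIV. commutator_bound N j \<le> gram_bound j" for N
    proof (rule AE_I2)
      fix j
      have "commutator_bound N j \<le> gram_bound j * ennreal 1"
        unfolding commutator_bound_def by (intro mult_left_mono ennreal_leI) auto
      then show "commutator_bound N j \<le> gram_bound j" by simp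
    qed
    show "AE j in count_space UNIV. (\<lambda>N. commutator_bound N j) \<longlonglongrightarrow> 0"
    proof (rule AE_I2)
      fix j
      have "gram_bound j \<noteq> top"
      proof
        assume "gram_bound j = top"
        moreover have "gram_bound j \<le> (\<integral>\<^sup>+i. gram_bound i \<partial>count_space UNIV)"
          by (rule nn_integral_ge_point) simp
        ultimately show False
          using gram_bound_summable by (simp add: top_unique)
      qed
      have "(\<lambda>N. (real_of_int \<bar>j\<bar> + 1) / real N) \<longlonglongrightarrow> 0"
        by (rule lim_const_over_n)
      then have "(\<lambda>N. min 1 ((real_of_int \<bar>j\<bar> + 1) / real N)) \<longlonglongrightarrow> min 1 0"
        by (intro tendsto_min tendsto_const)
      then have "(\<lambda>N. ennreal (min 1 ((real_of_int \<bar>j\<bar> + 1) / real N))) \<longlonglongrightarrow> ennreal (min 1 0)"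
        by (rule tendsto_ennrealI)
      then show "(\<lambda>N. commutator_bound N j) \<longlonglongrightarrow> 0"
        unfolding commutator_bound_def using ennreal_tendsto_cmult[of "gram_bound j"] \<open>gram_bound j \<noteq> top\<close>
        by (fastforce simp: less_top)
    qed
  qed (use gram_bound_summable in auto)
  then show ?thesis by simp
qed

text \<open>
  A bound for the row and column sums of the commutator between block \<open>m\<close> and the neighbourhood
  of block \<open>n\<close>.  If \<open>\<gamma>\<close> lies in block \<open>n - 1\<close>, \<open>n\<close> or \<open>n + 1\<close> and \<open>\<gamma>'\<close> in block \<open>m\<close>, then
  \<open>\<lfloor>(\<gamma> - \<gamma>') / N\<rfloor>\<close> differs from \<open>n - m\<close> by one of \<open>-2, -1, 0, 1\<close>.
\<close>

definition block_coupling :: "nat \<Rightarrow> int \<Rightarrow> int \<Rightarrow> ennreal" where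
  "block_coupling N n m = of_nat K
    * (\<integral>\<^sup>+j. commutator_bound N j * indicator {-2..1} (j div int N - (n - m)) \<partial>count_space UNIV)"

text \<open>
  Each \<open>j\<close> contributes to exactly four values of \<open>n - m\<close>.
\<close>

lemma sum_block_coupling:
  "(\<integral>\<^sup>+m. block_coupling N n m \<partial>count_space UNIV) = of_nat K * (4 * (\<integral>\<^sup>+j. commutator_bound N j \<partial>count_space UNIV))"
  "(\<integral>\<^sup>+n. block_coupling N n m \<partial>count_space UNIV) = of_nat K * (4 * (\<integral>\<^sup>+j. commutator_bound N j \<partial>count_space UNIV))"
proof -
  have *: "(\<integral>\<^sup>+m. of_nat K * (\<integral>\<^sup>+j. commutator_bound N j * indicator {-2..1} (t j m) \<partial>count_space UNIV) \<partial>count_space UNIV)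
      = of_nat K * (4 * (\<integral>\<^sup>+j. commutator_bound N j \<partial>count_space UNIV))"
    if t: "\<And>j. (\<integral>\<^sup>+m. indicator {-2..1} (t j m) \<partial>count_space UNIV) = (4::ennreal)"
    for t :: "int \<Rightarrow> int \<Rightarrow> int"
  proof -
    have "(\<integral>\<^sup>+m. \<integral>\<^sup>+j. commutator_bound N j * indicator {-2..1} (t j m) \<partial>count_space UNIV \<partial>count_space UNIV)
        = (\<integral>\<^sup>+j. \<integral>\<^sup>+m. commutator_bound N j * indicator {-2..1} (t j m) \<partial>count_space UNIV \<partial>count_space UNIV)"
      by (rule nn_integral_swap_count_space) simp_all
    also have "\<dots> = (\<integral>\<^sup>+j. commutator_bound N j * 4 \<partial>count_space UNIV)"
      by (simp add: nn_integral_cmult t)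
    also have "\<dots> = 4 * (\<integral>\<^sup>+j. commutator_bound N j \<partial>count_space UNIV)"
      by (subst mult.commute) (rule nn_integral_cmult, simp)
    finally show ?thesis
      by (simp add: nn_integral_cmult)
  qed
  have card4: "(\<integral>\<^sup>+m. indicator {-2..1} m \<partial>count_space (UNIV :: int set)) = (4::ennreal)"
    by simp
  have "(\<integral>\<^sup>+m. indicator {-2..1} (j div int N - (n - m)) \<partial>count_space UNIV) = (4::ennreal)" for j
    using nn_integral_count_space_int_shift[of "indicator {-2..1}" "j div int N - n"]
    unfolding card4 by (simp add: algebra_simps)
  then show "(\<integral>\<^sup>+m. block_coupling N n m \<partial>count_space UNIV) = of_nat K * (4 * (\<integral>\<^sup>+j. commutator_bound N j \<partial>count_space UNIV))"
    unfolding block_coupling_def by (rule *)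
  have "(\<integral>\<^sup>+n. indicator {-2..1} (j div int N - (n - m)) \<partial>count_space UNIV) = (4::ennreal)" for j
    using nn_integral_count_space_int_reflect[of "indicator {-2..1}" "j div int N + m"]
    unfolding card4 by (simp add: algebra_simps)
  then show "(\<integral>\<^sup>+n. block_coupling N n m \<partial>count_space UNIV) = of_nat K * (4 * (\<integral>\<^sup>+j. commutator_bound N j \<partial>count_space UNIV))"
    unfolding block_coupling_def by (rule *)
qed

lemma block_kernel_sums:
  assumes N: "0 < N"
  shows "\<gamma> \<in> near_block N n \<Longrightarrow> (\<Sum>\<gamma>'\<in>block N m. commutator_bound N \<lfloor>\<gamma> - \<gamma>'\<rfloor>) \<le> block_coupling N n m"
    and "\<gamma>' \<in> block N m \<Longrightarrow> (\<Sum>\<gamma>\<in>near_block N n. commutator_bound N \<lfloor>\<gamma> - \<gamma>'\<rfloor>) \<le> block_coupling N n m"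
proof -
  define h where "h j = commutator_bound N j * indicator {-2..1} (j div int N - (n - m))" for j
  have coupling: "block_coupling N n m = of_nat K * (\<integral>\<^sup>+j. h j \<partial>count_space UNIV)"
    by (simp add: block_coupling_def h_def)
  have h: "commutator_bound N \<lfloor>\<gamma> - \<gamma>'\<rfloor> = h \<lfloor>\<gamma> - \<gamma>'\<rfloor>" if "\<gamma> \<in> near_block N n" "\<gamma>' \<in> block N m" for \<gamma> \<gamma>'
  proof -
    have fl: "n - 1 \<le> \<lfloor>\<gamma> / real N\<rfloor>" "\<lfloor>\<gamma> / real N\<rfloor> \<le> n + 1" "\<lfloor>\<gamma>' / real N\<rfloor> = m"
      using that by (auto simp: near_block_def block_def)
    have "\<lfloor>\<gamma> - \<gamma>'\<rfloor> div int N = \<lfloor>(\<gamma> - \<gamma>') / real N\<rfloor>"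
      using floor_divide_real_eq_div[of "int N" "\<gamma> - \<gamma>'"] by simp
    also have "\<dots> = \<lfloor>\<gamma> / real N - \<gamma>' / real N\<rfloor>"
      by (simp add: diff_divide_distrib)
    finally have eq: "\<lfloor>\<gamma> - \<gamma>'\<rfloor> div int N = \<lfloor>\<gamma> / real N - \<gamma>' / real N\<rfloor>" .
    have "n - m - 2 \<le> \<lfloor>\<gamma> / real N - \<gamma>' / real N\<rfloor>" "\<lfloor>\<gamma> / real N - \<gamma>' / real N\<rfloor> \<le> n - m + 1"
      using fl by linarith+
    then show ?thesis
      by (simp add: h_def eq)
  qed
  have sum_le: "(\<Sum>t\<in>T. f t) \<le> (\<integral>\<^sup>+t. f t \<partial>count_space \<Gamma>)" if "finite T" "T \<subseteq> \<Gamma>" for T and f :: "real \<Rightarrow> ennreal"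
  proof -
    have "(\<Sum>t\<in>T. f t) = (\<integral>\<^sup>+t. f t * indicator T t \<partial>count_space \<Gamma>)"
      by (subst nn_integral_count_space'[OF that(1) _ that(2)]) auto
    also have "\<dots> \<le> (\<integral>\<^sup>+t. f t \<partial>count_space \<Gamma>)"
      by (intro nn_integral_mono) (auto split: split_indicator)
    finally show ?thesis .
  qed
  have sub: "near_block N n \<subseteq> \<Gamma>" "block N m \<subseteq> \<Gamma>"
    by (auto simp: near_block_def block_def)
  show "(\<Sum>\<gamma>'\<in>block N m. commutator_bound N \<lfloor>\<gamma> - \<gamma>'\<rfloor>) \<le> block_coupling N n m" if \<gamma>: "\<gamma> \<in> near_block N n"
  proof -
    have "(\<Sum>\<gamma>'\<in>block N m. commutator_bound N \<lfloor>\<gamma> - \<gamma>'\<rfloor>) = (\<Sum>\<gamma>'\<in>block N m. h \<lfloor>\<gamma> - \<gamma>'\<rfloor>)"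
      using h[OF \<gamma>] by (intro sum.cong) auto
    also have "\<dots> \<le> (\<integral>\<^sup>+\<gamma>'. h \<lfloor>\<gamma> - \<gamma>'\<rfloor> \<partial>count_space \<Gamma>)"
      by (rule sum_le[OF finite_block[OF N] sub(2)])
    also have "\<dots> \<le> block_coupling N n m"
      unfolding coupling by (rule nn_integral_floor_diff_le(1))
    finally show ?thesis .
  qed
  show "(\<Sum>\<gamma>\<in>near_block N n. commutator_bound N \<lfloor>\<gamma> - \<gamma>'\<rfloor>) \<le> block_coupling N n m" if \<gamma>': "\<gamma>' \<in> block N m"
  proof -
    have "(\<Sum>\<gamma>\<in>near_block N n. commutator_bound N \<lfloor>\<gamma> - \<gamma>'\<rfloor>) = (\<Sum>\<gamma>\<in>near_block N n. h \<lfloor>\<gamma> - \<gamma>'\<rfloor>)"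
      using h[OF _ \<gamma>'] by (intro sum.cong) auto
    also have "\<dots> \<le> (\<integral>\<^sup>+\<gamma>. h \<lfloor>\<gamma> - \<gamma>'\<rfloor> \<partial>count_space \<Gamma>)"
      by (rule sum_le[OF finite_near_block[OF N] sub(1)])
    also have "\<dots> \<le> block_coupling N n m"
      unfolding coupling by (rule nn_integral_floor_diff_le(2))
    finally show ?thesis .
  qed
qed

lemma nn_integral_blocks:
  assumes N: "0 < N"
  shows "(\<integral>\<^sup>+\<gamma>. f \<gamma> \<partial>count_space \<Gamma>) = (\<integral>\<^sup>+m. (\<Sum>\<gamma>\<in>block N m. f \<gamma>) \<partial>count_space UNIV)"
proof -
  have "(\<integral>\<^sup>+\<gamma>. f \<gamma> \<partial>count_space \<Gamma>)
      = (\<integral>\<^sup>+\<gamma>. \<integral>\<^sup>+m. f \<gamma> * indicator {\<lfloor>\<gamma> / real N\<rfloor>} m \<partial>count_space UNIV \<partial>count_space \<Gamma>)"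
    by (intro nn_integral_cong) simp
  also have "\<dots> = (\<integral>\<^sup>+m. \<integral>\<^sup>+\<gamma>. f \<gamma> * indicator {\<lfloor>\<gamma> / real N\<rfloor>} m \<partial>count_space \<Gamma> \<partial>count_space UNIV)"
    by (rule nn_integral_swap_count_space) (simp_all add: countable)
  also have "\<dots> = (\<integral>\<^sup>+m. (\<Sum>\<gamma>\<in>block N m. f \<gamma>) \<partial>count_space UNIV)"
  proof (rule nn_integral_cong)
    fix m
    have "(\<integral>\<^sup>+\<gamma>. f \<gamma> * indicator {\<lfloor>\<gamma> / real N\<rfloor>} m \<partial>count_space \<Gamma>)
        = (\<integral>\<^sup>+\<gamma>. f \<gamma> * indicator (block N m) \<gamma> \<partial>count_space \<Gamma>)"
      by (intro nn_integral_cong) (auto simp: block_def split: split_indicator)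
    also have "\<dots> = (\<Sum>\<gamma>\<in>block N m. f \<gamma>)"
      by (subst nn_integral_count_space'[OF finite_block[OF N, of m]]) (auto simp: block_def)
    finally show "(\<integral>\<^sup>+\<gamma>. f \<gamma> * indicator {\<lfloor>\<gamma> / real N\<rfloor>} m \<partial>count_space \<Gamma>) = (\<Sum>\<gamma>\<in>block N m. f \<gamma>)" .
  qed
  finally show ?thesis .
qed

text \<open>
  The coercivity assumption is applied to the cut-off sequence \<open>b = \<psi>\<^sub>n c\<close> with \<open>l\<^sup>2\<close> norm \<open>X\<close>.  The
  energy identity and the commutator estimate give \<open>C * X\<^sup>2 \<le> X * (V + W)\<close>, where the bilinear form
  of the commutator is bounded block by block; it remains to cancel \<open>X\<close>, which is at least
  the \<open>l\<^sup>2\<close> norm of \<open>c\<close> on block \<open>n\<close>.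
\<close>

lemma localized_lower_bound:
  fixes c :: "real \<Rightarrow> complex"
  assumes N: "0 < N" and C: "0 < C"
    and coercive: "\<And>b S. finite S \<Longrightarrow> S \<subseteq> \<Gamma> \<Longrightarrow> (\<And>\<gamma>. \<gamma> \<in> \<Gamma> \<Longrightarrow> \<gamma> \<notin> S \<Longrightarrow> b \<gamma> = 0) \<Longrightarrow>
      ennreal (C * (\<Sum>\<gamma>\<in>S. (norm (b \<gamma>))\<^sup>2)) \<le> (\<integral>\<^sup>+x. ennreal ((norm (synth b x))\<^sup>2) \<partial>lborel)"
    and c: "\<And>\<gamma>. \<gamma> \<in> \<Gamma> \<Longrightarrow> norm (c \<gamma>) \<le> B" and B: "0 \<le> B"
  shows "ennreal C * ennreal (L2_set (\<lambda>\<gamma>. norm (c \<gamma>)) (block N n))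
    \<le> (\<Sum>\<gamma>\<in>near_block N n. ennreal (norm (analysis (synth c) \<gamma>)))
      + (\<integral>\<^sup>+m. block_coupling N n m * ennreal (L2_set (\<lambda>\<gamma>. norm (c \<gamma>)) (block N m)) \<partial>count_space UNIV)"
    (is "_ \<le> ?V + ?W")
proof -
  let ?S = "near_block N n" and ?\<psi> = "cutoff N n" and ?d = "analysis (synth c)"
  let ?u = "\<lambda>m. L2_set (\<lambda>\<gamma>. norm (c \<gamma>)) (block N m)"
  define b where "b = (\<lambda>t. complex_of_real (?\<psi> t) * c t)"
  define X where "X = L2_set (\<lambda>\<gamma>. norm (b \<gamma>)) ?S"
  have X0: "0 \<le> X" by (simp add: X_def)
  have S: "finite ?S" "?S \<subseteq> \<Gamma>"
    using finite_near_block[OF N] by (auto simp: near_block_def)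
  have b0: "b \<gamma> = 0" if "\<gamma> \<in> \<Gamma>" "\<gamma> \<notin> ?S" for \<gamma>
    using that cutoff_eq_0[of \<gamma> N n] by (auto simp: b_def near_block_def)
  have u_le: "?u n \<le> X"
  proof -
    have "?u n = L2_set (\<lambda>\<gamma>. norm (b \<gamma>)) (block N n)"
      by (intro L2_set_cong) (auto simp: b_def block_def cutoff_eq_1)
    also have "\<dots> \<le> X"
      unfolding X_def L2_set_def using S(1) block_subset
      by (intro real_sqrt_le_mono sum_mono2) auto
    finally show ?thesis .
  qed
  have local_bound: "ennreal (norm (analysis (synth b) \<gamma>))
      \<le> ennreal (norm (?d \<gamma>)) + (\<integral>\<^sup>+\<gamma>'. commutator_bound N \<lfloor>\<gamma> - \<gamma>'\<rfloor> * ennreal (norm (c \<gamma>')) \<partial>count_space \<Gamma>)"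
    for \<gamma>
  proof -
    have "norm (analysis (synth b) \<gamma>)
        \<le> norm (?\<psi> \<gamma> * ?d \<gamma>) + norm (analysis (synth b) \<gamma> - ?\<psi> \<gamma> * ?d \<gamma>)"
      by (rule norm_triangle_sub)
    also have "norm (?\<psi> \<gamma> * ?d \<gamma>) \<le> norm (?d \<gamma>)"
      using cutoff_bounds[of N n \<gamma>] mult_right_mono[of "?\<psi> \<gamma>" 1 "norm (?d \<gamma>)"]
      by (simp add: norm_mult)
    finally have "ennreal (norm (analysis (synth b) \<gamma>))
        \<le> ennreal (norm (?d \<gamma>) + norm (analysis (synth b) \<gamma> - ?\<psi> \<gamma> * ?d \<gamma>))"
      by (intro ennreal_leI) simp
    also have "\<dots> = ennreal (norm (?d \<gamma>)) + ennreal (norm (analysis (synth b) \<gamma> - ?\<psi> \<gamma> * ?d \<gamma>))"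
      by simp
    also have "ennreal (norm (analysis (synth b) \<gamma> - ?\<psi> \<gamma> * ?d \<gamma>))
        \<le> (\<integral>\<^sup>+\<gamma>'. gram_bound \<lfloor>\<gamma> - \<gamma>'\<rfloor> * (ennreal \<bar>?\<psi> \<gamma>' - ?\<psi> \<gamma>\<bar> * ennreal (norm (c \<gamma>')))
          \<partial>count_space \<Gamma>)"
      unfolding b_def by (rule norm_commutator_le[OF c B cutoff_bounds])
    also have "\<dots> \<le> (\<integral>\<^sup>+\<gamma>'. commutator_bound N \<lfloor>\<gamma> - \<gamma>'\<rfloor> * ennreal (norm (c \<gamma>')) \<partial>count_space \<Gamma>)"
    proof (intro nn_integral_mono)
      fix \<gamma>'
      have "\<bar>?\<psi> \<gamma>' - ?\<psi> \<gamma>\<bar> \<le> min 1 (\<bar>\<gamma> - \<gamma>'\<bar> / real N)"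
        by (rule cutoff_lipschitz)
      also have "\<dots> \<le> min 1 ((real_of_int \<bar>\<lfloor>\<gamma> - \<gamma>'\<rfloor>\<bar> + 1) / real N)"
        using N by (intro min.mono divide_right_mono) linarith+
      finally have "gram_bound \<lfloor>\<gamma> - \<gamma>'\<rfloor> * ennreal \<bar>?\<psi> \<gamma>' - ?\<psi> \<gamma>\<bar> \<le> commutator_bound N \<lfloor>\<gamma> - \<gamma>'\<rfloor>"
        unfolding commutator_bound_def by (intro mult_left_mono ennreal_leI) simp_all
      then show "gram_bound \<lfloor>\<gamma> - \<gamma>'\<rfloor> * (ennreal \<bar>?\<psi> \<gamma>' - ?\<psi> \<gamma>\<bar> * ennreal (norm (c \<gamma>')))
          \<le> commutator_bound N \<lfloor>\<gamma> - \<gamma>'\<rfloor> * ennreal (norm (c \<gamma>'))"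
        unfolding mult.assoc[symmetric] by (rule mult_right_mono) simp
    qed
    finally show ?thesis
      by (simp add: add_left_mono)
  qed
  have "ennreal (C * X\<^sup>2) = ennreal (C * (\<Sum>\<gamma>\<in>?S. (norm (b \<gamma>))\<^sup>2))"
    by (simp add: X_def L2_set_def sum_nonneg)
  also have "\<dots> \<le> (\<integral>\<^sup>+x. ennreal ((norm (synth b x))\<^sup>2) \<partial>lborel)"
    by (rule coercive[OF S b0])
  also have "\<dots> \<le> (\<Sum>\<gamma>\<in>?S. ennreal (norm (b \<gamma>)) * ennreal (norm (analysis (synth b) \<gamma>)))"
    by (rule energy_le[OF S b0])
  also have "\<dots> \<le> (\<Sum>\<gamma>\<in>?S. ennreal (norm (b \<gamma>)) * (ennreal (norm (?d \<gamma>))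
      + (\<integral>\<^sup>+\<gamma>'. commutator_bound N \<lfloor>\<gamma> - \<gamma>'\<rfloor> * ennreal (norm (c \<gamma>')) \<partial>count_space \<Gamma>)))"
    by (intro sum_mono mult_left_mono local_bound) simp
  also have "\<dots> = (\<Sum>\<gamma>\<in>?S. ennreal (norm (b \<gamma>)) * ennreal (norm (?d \<gamma>)))
      + (\<Sum>\<gamma>\<in>?S. ennreal (norm (b \<gamma>))
        * (\<integral>\<^sup>+\<gamma>'. commutator_bound N \<lfloor>\<gamma> - \<gamma>'\<rfloor> * ennreal (norm (c \<gamma>')) \<partial>count_space \<Gamma>))"
    by (simp add: distrib_left sum.distrib)
  also have "\<dots> \<le> ennreal X * ?V + ennreal X * ?W"
  proof (rule add_mono)
    show "(\<Sum>\<gamma>\<in>?S. ennreal (norm (b \<gamma>)) * ennreal (norm (?d \<gamma>))) \<le> ennreal X * ?V"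
      unfolding sum_distrib_left X_def using S(1)
      by (intro sum_mono mult_right_mono ennreal_leI member_le_L2_set) auto
    have "(\<Sum>\<gamma>\<in>?S. ennreal (norm (b \<gamma>))
        * (\<integral>\<^sup>+\<gamma>'. commutator_bound N \<lfloor>\<gamma> - \<gamma>'\<rfloor> * ennreal (norm (c \<gamma>')) \<partial>count_space \<Gamma>))
      = (\<Sum>\<gamma>\<in>?S. \<integral>\<^sup>+m. (\<Sum>\<gamma>'\<in>block N m. ennreal (norm (b \<gamma>)) * commutator_bound N \<lfloor>\<gamma> - \<gamma>'\<rfloor>
          * ennreal (norm (c \<gamma>'))) \<partial>count_space UNIV)"
      unfolding nn_integral_blocks[OF N]
      by (simp add: nn_integral_cmult[symmetric] sum_distrib_left mult.assoc)
    also have "\<dots> = (\<integral>\<^sup>+m. (\<Sum>\<gamma>\<in>?S. \<Sum>\<gamma>'\<in>block N m. ennreal (norm (b \<gamma>)) * commutator_bound N \<lfloor>\<gamma> - \<gamma>'\<rfloor>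
          * ennreal (norm (c \<gamma>'))) \<partial>count_space UNIV)"
      by (rule nn_integral_sum[symmetric]) simp
    also have "\<dots> \<le> (\<integral>\<^sup>+m. block_coupling N n m * ennreal (X * ?u m) \<partial>count_space UNIV)"
      unfolding X_def using finite_near_block[OF N] finite_block[OF N] block_kernel_sums[OF N]
      by (intro nn_integral_mono bilinear_Schur_test) auto
    also have "\<dots> = (\<integral>\<^sup>+m. ennreal X * (block_coupling N n m * ennreal (?u m)) \<partial>count_space UNIV)"
      using X0 by (intro nn_integral_cong) (simp add: ennreal_mult ac_simps)
    also have "\<dots> = ennreal X * ?W"
      by (rule nn_integral_cmult) simp
    finally show "(\<Sum>\<gamma>\<in>?S. ennreal (norm (b \<gamma>))
        * (\<integral>\<^sup>+\<gamma>'. commutator_bound N \<lfloor>\<gamma> - \<gamma>'\<rfloor> * ennreal (norm (c \<gamma>')) \<partial>count_space \<Gamma>)) \<le> ennreal X * ?W" .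
  qed
  finally have main: "ennreal X * ennreal (C * X) \<le> ennreal X * (?V + ?W)"
    using X0 C by (simp add: distrib_left ennreal_mult[symmetric] power2_eq_square ac_simps)
  show ?thesis
  proof (cases "X = 0")
    case True
    then have "?u n = 0"
      using u_le L2_set_nonneg[of "\<lambda>\<gamma>. norm (c \<gamma>)" "block N n"] by linarith
    then show ?thesis by simp
  next
    case False
    then have "ennreal (C * X) \<le> ?V + ?W"
      using main X0 by (simp add: ennreal_mult_le_mult_iff)
    moreover have "ennreal C * ennreal (?u n) \<le> ennreal (C * X)"
      using u_le C by (simp add: ennreal_mult[symmetric] ennreal_leI)
    ultimately show ?thesis
      by (rule order_trans[rotated])
  qed
qed

section \<open>From blocks to the lower stability bound\<close>

text \<open>
  Schur's test turns the localized bound into one in \<open>l\<^sup>p\<close> over the blocks, where the coupling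
  term is absorbed.  It also moves between norms over points and norms over blocks, as the relation
  \<open>\<gamma> \<in> near_block N n\<close> has bounded multiplicity on both sides.
\<close>

lemma lp_lower_bound:
  assumes C: "0 < C"
    and coercive: "\<And>b S. finite S \<Longrightarrow> S \<subseteq> \<Gamma> \<Longrightarrow> (\<And>\<gamma>. \<gamma> \<in> \<Gamma> \<Longrightarrow> \<gamma> \<notin> S \<Longrightarrow> b \<gamma> = 0) \<Longrightarrow>
      ennreal (C * (\<Sum>\<gamma>\<in>S. (norm (b \<gamma>))\<^sup>2)) \<le> (\<integral>\<^sup>+x. ennreal ((norm (synth b x))\<^sup>2) \<partial>lborel)"
    and p: "1 \<le> p"
  shows "\<exists>A>0. \<forall>c. nn_Lp p (count_space \<Gamma>) (\<lambda>\<gamma>. ennreal (norm (c \<gamma>))) < top \<longrightarrow>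
    nn_Lp p (count_space \<Gamma>) (\<lambda>\<gamma>. ennreal (norm (c \<gamma>)))
      \<le> ennreal A * nn_Lp p lborel (\<lambda>x. ennreal (norm (synth c x)))"
proof -
  \<comment> \<open>By lemma \<open>sum_block_coupling\<close> this choice makes the row and column sums of the coupling at
    most \<open>C / 8\<close>, hence at most \<open>1 / 8\<close> after division by \<open>C\<close>, as lemma \<open>nn_Lp_absorb\<close> requires.\<close>
  obtain N where N: "0 < N" "(\<integral>\<^sup>+j. commutator_bound N j \<partial>count_space UNIV) < ennreal (C / (32 * (real K + 1)))"
  proof -
    have "eventually (\<lambda>N. (\<integral>\<^sup>+j. commutator_bound N j \<partial>count_space UNIV) < ennreal (C / (32 * (real K + 1)))) sequentially"
      using C by (intro order_tendstoD(2)[OF commutator_bound_tendsto_0]) simp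
    then have "eventually (\<lambda>N. 0 < N \<and>
        (\<integral>\<^sup>+j. commutator_bound N j \<partial>count_space UNIV) < ennreal (C / (32 * (real K + 1)))) sequentially"
      using eventually_gt_at_top[of 0] by eventually_elim simp
    then show ?thesis
      using that by (auto simp: eventually_sequentially)
  qed
  have small: "of_nat K * (4 * (\<integral>\<^sup>+j. commutator_bound N j \<partial>count_space UNIV)) \<le> ennreal (C / 8)"
  proof -
    have "of_nat K * (4 * (\<integral>\<^sup>+j. commutator_bound N j \<partial>count_space UNIV))
        \<le> ennreal (real K) * (ennreal 4 * ennreal (C / (32 * (real K + 1))))"
      using N(2) by (intro mult_mono) (auto simp: ennreal_of_nat_eq_real_of_nat)
    also have "\<dots> = ennreal (real K * (4 * (C / (32 * (real K + 1)))))"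
    proof -
      have "ennreal (real K) * (ennreal 4 * ennreal y) = ennreal (real K * (4 * y))" if "0 \<le> y" for y
        using that by (simp add: ennreal_mult)
      then show ?thesis
        using C by simp
    qed
    also have "\<dots> \<le> ennreal (C / 8)"
      using C by (intro ennreal_leI) (simp add: field_simps)
    finally show ?thesis .
  qed
  \<comment> \<open>A bound both for the number of points near a block and for the number \<open>3\<close> of blocks near a
    point.\<close>
  define Q where "Q = real K * (3 * real N) + 3"
  have Q: "0 < Q" by (simp add: Q_def add_nonneg_pos)
  interpret blocks_points: pair_sigma_finite "count_space (UNIV :: int set)" "count_space \<Gamma>"
    by (intro pair_sigma_finite.intro sigma_finite_measure_count_space_countable) (simp_all add: countable)
  interpret points_blocks: pair_sigma_finite "count_space \<Gamma>" "count_space (UNIV :: int set)"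
    by (intro pair_sigma_finite.intro sigma_finite_measure_count_space_countable) (simp_all add: countable)
  interpret blocks_blocks: pair_sigma_finite "count_space (UNIV :: int set)" "count_space (UNIV :: int set)"
    by (intro pair_sigma_finite.intro sigma_finite_measure_count_space_countable) simp_all
  have rows: "(\<integral>\<^sup>+\<gamma>. indicator (near_block N n) \<gamma> \<partial>count_space \<Gamma>) \<le> ennreal Q" for n
    by (rule order_trans[OF near_block_rows[OF N(1)]]) (auto simp: Q_def intro!: ennreal_leI)
  have cols: "(\<integral>\<^sup>+n. indicator (near_block N n) \<gamma> \<partial>count_space UNIV) \<le> ennreal Q" if "\<gamma> \<in> \<Gamma>" for \<gamma>
  proof -
    have "(3 :: ennreal) = ennreal 3" by simp
    also have "\<dots> \<le> ennreal Q"
      by (intro ennreal_leI) (simp add: Q_def)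
    finally show ?thesis
      unfolding near_block_cols[OF that] .
  qed
  have to_blocks: "nn_Lp p (count_space UNIV) f \<le> ennreal Q * nn_Lp p (count_space \<Gamma>) e"
    if "\<And>n. f n \<le> (\<Sum>\<gamma>\<in>near_block N n. e \<gamma>)" for f e
  proof (rule Schur_test[where K = "\<lambda>n. indicator (near_block N n)"])
    fix n
    have "(\<integral>\<^sup>+\<gamma>. indicator (near_block N n) \<gamma> * e \<gamma> \<partial>count_space \<Gamma>) = (\<Sum>\<gamma>\<in>near_block N n. e \<gamma>)"
      by (subst nn_integral_count_space'[OF finite_near_block[OF N(1), of n]])
        (auto simp: near_block_def)
    with that show "f n \<le> (\<integral>\<^sup>+\<gamma>. indicator (near_block N n) \<gamma> * e \<gamma> \<partial>count_space \<Gamma>)"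
      by simp
  qed (use rows cols Q p in \<open>simp_all add: pair_measure_countable countable blocks_points.pair_sigma_finite_axioms\<close>)
  \<comment> \<open>The factors belong to the steps from \<open>c\<close> to \<open>u\<close>, from \<open>u\<close> to \<open>v\<close> by absorption, from \<open>v\<close> to
    \<open>T\<^sup>* T c\<close>, and from there to \<open>T c\<close>.\<close>
  define A where "A = Q * (8 * ((1 / C) * (Q * schur_const)))"
  have "0 < A"
    using Q schur_const_pos C by (simp add: A_def)
  moreover have "nn_Lp p (count_space \<Gamma>) (\<lambda>\<gamma>. ennreal (norm (c \<gamma>)))
      \<le> ennreal A * nn_Lp p lborel (\<lambda>x. ennreal (norm (synth c x)))"
    if fin: "nn_Lp p (count_space \<Gamma>) (\<lambda>\<gamma>. ennreal (norm (c \<gamma>))) < top" for c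
  proof -
    let ?d = "analysis (synth c)"
    define u where "u m = ennreal (L2_set (\<lambda>\<gamma>. norm (c \<gamma>)) (block N m))" for m
    define v where "v n = ennreal (1 / C) * (\<Sum>\<gamma>\<in>near_block N n. ennreal (norm (?d \<gamma>)))" for n
    define w where "w n = (\<integral>\<^sup>+m. ennreal (1 / C) * block_coupling N n m * u m \<partial>count_space UNIV)" for n
    obtain B where B: "0 \<le> B" "\<And>\<gamma>. \<gamma> \<in> \<Gamma> \<Longrightarrow> norm (c \<gamma>) \<le> B"
    proof
      show "0 \<le> enn2real (nn_Lp p (count_space \<Gamma>) (\<lambda>\<gamma>. ennreal (norm (c \<gamma>))))"
        by simp
      show "norm (c \<gamma>) \<le> enn2real (nn_Lp p (count_space \<Gamma>) (\<lambda>\<gamma>. ennreal (norm (c \<gamma>))))"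
        if "\<gamma> \<in> \<Gamma>" for \<gamma>
        using enn2real_mono[OF le_nn_Lp_count_space[OF that p, of "\<lambda>\<gamma>. ennreal (norm (c \<gamma>))"] fin]
        by simp
    qed
    have uvw: "u n \<le> v n + w n" for n
    proof -
      have "u n = ennreal (1 / C) * (ennreal C * u n)"
        using C by (simp add: mult.assoc[symmetric] ennreal_mult[symmetric])
      also have "\<dots> \<le> ennreal (1 / C) * ((\<Sum>\<gamma>\<in>near_block N n. ennreal (norm (?d \<gamma>)))
          + (\<integral>\<^sup>+m. block_coupling N n m * u m \<partial>count_space UNIV))"
        unfolding u_def
        by (intro mult_left_mono localized_lower_bound[OF N(1) C coercive B(2) B(1)]) simp_all
      also have "\<dots> = v n + w n"
        by (simp add: v_def w_def distrib_left nn_integral_cmult mult.assoc)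
      finally show ?thesis .
    qed
    have u_le_c: "nn_Lp p (count_space UNIV) u
        \<le> ennreal Q * nn_Lp p (count_space \<Gamma>) (\<lambda>\<gamma>. ennreal (norm (c \<gamma>)))"
    proof (rule to_blocks)
      fix n
      have "L2_set (\<lambda>\<gamma>. norm (c \<gamma>)) (block N n) \<le> (\<Sum>\<gamma>\<in>block N n. norm (c \<gamma>))"
        by (rule L2_set_le_sum) simp
      also have "\<dots> \<le> (\<Sum>\<gamma>\<in>near_block N n. norm (c \<gamma>))"
        using finite_near_block[OF N(1)] block_subset by (intro sum_mono2) auto
      finally show "u n \<le> (\<Sum>\<gamma>\<in>near_block N n. ennreal (norm (c \<gamma>)))"
        by (simp add: u_def sum_ennreal ennreal_leI)
    qed
    then have u_fin: "nn_Lp p (count_space UNIV) u < top"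
      using fin by (auto simp: ennreal_mult_less_top intro: le_less_trans)
    have c_le_u: "nn_Lp p (count_space \<Gamma>) (\<lambda>\<gamma>. ennreal (norm (c \<gamma>)))
        \<le> ennreal Q * nn_Lp p (count_space UNIV) u"
    proof (rule Schur_test[where K = "\<lambda>\<gamma> n. indicator (near_block N n) \<gamma>"])
      fix \<gamma> assume "\<gamma> \<in> space (count_space \<Gamma>)"
      then have \<gamma>: "\<gamma> \<in> \<Gamma>" by simp
      let ?k = "\<lfloor>\<gamma> / real N\<rfloor>"
      have k: "\<gamma> \<in> block N ?k"
        using \<gamma> by (simp add: block_def)
      then have "norm (c \<gamma>) \<le> L2_set (\<lambda>\<gamma>. norm (c \<gamma>)) (block N ?k)"
        by (rule member_le_L2_set[OF finite_block[OF N(1)], of _ _ "\<lambda>\<gamma>. norm (c \<gamma>)"])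
      then have "ennreal (norm (c \<gamma>)) \<le> indicator (near_block N ?k) \<gamma> * u ?k"
        using k block_subset[of N ?k] by (auto simp: u_def ennreal_leI)
      also have "\<dots> \<le> (\<integral>\<^sup>+n. indicator (near_block N n) \<gamma> * u n \<partial>count_space UNIV)"
        by (rule nn_integral_ge_point) simp
      finally show "ennreal (norm (c \<gamma>)) \<le> \<dots>" .
    qed (use rows cols Q p in \<open>simp_all add: pair_measure_countable countable points_blocks.pair_sigma_finite_axioms\<close>)
    have scaled_coupling: "ennreal (1 / C) * (of_nat K * (4 * (\<integral>\<^sup>+j. commutator_bound N j \<partial>count_space UNIV))) \<le> ennreal (1 / 8)"
    proof -
      have "ennreal (1 / C) * (of_nat K * (4 * (\<integral>\<^sup>+j. commutator_bound N j \<partial>count_space UNIV)))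
          \<le> ennreal (1 / C) * ennreal (C / 8)"
        by (intro mult_left_mono small) simp
      also have "\<dots> = ennreal (1 / 8)"
        using C by (simp add: ennreal_mult[symmetric] del: ennreal_divide_numeral)
      finally show ?thesis .
    qed
    have "nn_Lp p (count_space UNIV) w \<le> ennreal (1 / 8) * nn_Lp p (count_space UNIV) u"
    proof (rule Schur_test[where K = "\<lambda>n m. ennreal (1 / C) * block_coupling N n m"])
      show "(\<integral>\<^sup>+m. ennreal (1 / C) * block_coupling N n m \<partial>count_space UNIV) \<le> ennreal (1 / 8)" for n
        using scaled_coupling by (subst nn_integral_cmult) (simp_all only: sum_block_coupling, simp)
      show "(\<integral>\<^sup>+n. ennreal (1 / C) * block_coupling N n m \<partial>count_space UNIV) \<le> ennreal (1 / 8)" for m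
        using scaled_coupling by (subst nn_integral_cmult) (simp_all only: sum_block_coupling, simp)
    qed (use p in \<open>simp_all add: pair_measure_countable w_def blocks_blocks.pair_sigma_finite_axioms\<close>)
    then have "8 * nn_Lp p (count_space UNIV) w
        \<le> ennreal 8 * (ennreal (1 / 8) * nn_Lp p (count_space UNIV) u)"
      by (intro mult_mono) auto
    also have "\<dots> = nn_Lp p (count_space UNIV) u"
      unfolding mult.assoc[symmetric] by (subst ennreal_mult[symmetric]) simp_all
    finally have w_small: "8 * nn_Lp p (count_space UNIV) w \<le> nn_Lp p (count_space UNIV) u" .
    have v_le: "nn_Lp p (count_space UNIV) v
        \<le> ennreal (1 / C * Q) * nn_Lp p (count_space \<Gamma>) (\<lambda>\<gamma>. ennreal (norm (?d \<gamma>)))"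
    proof (rule Schur_test[where K = "\<lambda>n \<gamma>. ennreal (1 / C) * indicator (near_block N n) \<gamma>"])
      fix n
      have "(\<integral>\<^sup>+\<gamma>. ennreal (1 / C) * indicator (near_block N n) \<gamma> * ennreal (norm (?d \<gamma>)) \<partial>count_space \<Gamma>)
          = v n"
        unfolding v_def sum_distrib_left
        by (subst nn_integral_count_space'[OF finite_near_block[OF N(1), of n]])
          (auto simp: near_block_def)
      then show "v n \<le> (\<integral>\<^sup>+\<gamma>. ennreal (1 / C) * indicator (near_block N n) \<gamma>
          * ennreal (norm (?d \<gamma>)) \<partial>count_space \<Gamma>)"
        by simp
      have CQ: "ennreal (1 / C * Q) = ennreal (1 / C) * ennreal Q"
        using C Q by (intro ennreal_mult) auto
      show "(\<integral>\<^sup>+\<gamma>. ennreal (1 / C) * indicator (near_block N n) \<gamma> \<partial>count_space \<Gamma>) \<le> ennreal (1 / C * Q)"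
        unfolding CQ by (subst nn_integral_cmult) (auto intro!: mult_left_mono rows)
      show "(\<integral>\<^sup>+n. ennreal (1 / C) * indicator (near_block N n) \<gamma> \<partial>count_space UNIV) \<le> ennreal (1 / C * Q)"
        if "\<gamma> \<in> space (count_space \<Gamma>)" for \<gamma>
        using that unfolding CQ by (subst nn_integral_cmult) (auto intro!: mult_left_mono cols)
    qed (use Q C p in \<open>simp_all add: pair_measure_countable countable blocks_points.pair_sigma_finite_axioms\<close>)
    let ?f = "nn_Lp p lborel (\<lambda>x. ennreal (norm (synth c x)))"
    have "nn_Lp p (count_space \<Gamma>) (\<lambda>\<gamma>. ennreal (norm (c \<gamma>)))
        \<le> ennreal Q * nn_Lp p (count_space UNIV) u"
      by (rule c_le_u)
    also have "\<dots> \<le> ennreal Q * (8 * nn_Lp p (count_space UNIV) v)"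
      by (intro mult_left_mono nn_Lp_absorb[where w = w] uvw w_small u_fin p) simp_all
    also have "\<dots> \<le> ennreal Q * (8 * (ennreal (1 / C * Q) * (ennreal schur_const * ?f)))"
      by (intro mult_left_mono order_trans[OF v_le] nn_Lp_analysis_le p) simp_all
    also have "\<dots> = ennreal A * ?f"
    proof -
      have "A = Q * (8 * ((1 / C * Q) * schur_const))"
        by (simp add: A_def)
      also have "ennreal \<dots> = ennreal Q * (ennreal 8 * (ennreal (1 / C * Q) * ennreal schur_const))"
        using Q C schur_const_pos by (subst ennreal_mult; (subst ennreal_mult)?; (subst ennreal_mult)?) simp_all
      finally show ?thesis
        by (simp add: mult.assoc)
    qed
    finally show ?thesis .
  qed
  ultimately show ?thesis
    by blast
qed

end

section \<open>Passage from the amalgam space to a dominated generator\<close>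

text \<open>
  The open unit intervals in the amalgam norm miss the integers, a null set.
\<close>

lemma amalgam_representative:
  assumes "G \<in> wiener_amalgam"
  obtains G' g where "G' \<in> borel_measurable borel" "\<And>x. ennreal (norm (G' x)) \<le> g \<lfloor>x\<rfloor>"
    "(\<integral>\<^sup>+k. g k \<partial>count_space UNIV) < top" "AE x in lborel. G x = G' x"
proof -
  define g where "g k = Lp_norm top (lebesgue_on {real_of_int k<..<real_of_int k + 1}) G" for k :: int
  have G: "G \<in> borel_measurable lebesgue" and fin: "amalgam_norm G < top"
    using assms by (auto simp: wiener_amalgam_def)
  have sum_g: "(\<integral>\<^sup>+k. g k \<partial>count_space UNIV) < top"
    using nn_integral_count_space_int_le_infsum[of g] fin
    by (auto simp: amalgam_norm_def g_def intro: le_less_trans)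
  have "AE x in lebesgue. x \<in> {real_of_int k<..<real_of_int k + 1} \<longrightarrow> ennreal (norm (G x)) \<le> g k" for k
  proof -
    have "AE x in lebesgue_on {real_of_int k<..<real_of_int k + 1}. ennreal (norm (G x)) \<le> g k"
      using esssup_AE[of "\<lambda>x. ennreal (norm (G x))" "lebesgue_on {real_of_int k<..<real_of_int k + 1}"]
      by (simp add: g_def Lp_norm_def)
    then show ?thesis
      by (subst (asm) AE_restrict_space_iff) simp_all
  qed
  then have "AE x in lebesgue. \<forall>k. x \<in> {real_of_int k<..<real_of_int k + 1} \<longrightarrow> ennreal (norm (G x)) \<le> g k"
    by (simp add: AE_all_countable)
  then have ae1: "AE x in lborel. \<forall>k. x \<in> {real_of_int k<..<real_of_int k + 1} \<longrightarrow> ennreal (norm (G x)) \<le> g k"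
    by (simp add: AE_completion_iff)
  have ae2: "AE x in lborel. (x :: real) \<notin> \<int>"
  proof (rule AE_not_in)
    show "(\<int> :: real set) \<in> null_sets lborel"
      unfolding Ints_def by (intro countable_imp_null_set_lborel countable_image) simp
  qed
  obtain G1 where G1 [measurable]: "G1 \<in> borel_measurable borel" and ae3: "AE x in lborel. G x = G1 x"
  proof -
    have "(\<lambda>x. Re (G x)) \<in> borel_measurable lebesgue" "(\<lambda>x. Im (G x)) \<in> borel_measurable lebesgue"
      using G by (auto simp: borel_measurable_complex_iff)
    then obtain r i where ri [measurable]: "r \<in> borel_measurable lborel" "i \<in> borel_measurable lborel"
      and re: "AE x in lborel. Re (G x) = r x" and im: "AE x in lborel. Im (G x) = i x"
      by (blast dest: completion_ex_borel_measurable_real)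
    from re im have "AE x in lborel. G x = Complex (r x) (i x)"
      by eventually_elim (simp add: complex_eq_iff)
    moreover have "(\<lambda>x. Complex (r x) (i x)) \<in> borel_measurable borel"
      using ri by (simp add: borel_measurable_complex_iff)
    ultimately show ?thesis
      using that by blast
  qed
  define G' where "G' x = (if ennreal (norm (G1 x)) \<le> g \<lfloor>x\<rfloor> then G1 x else 0)" for x
  show ?thesis
  proof
    show "G' \<in> borel_measurable borel"
      unfolding G'_def[abs_def] by measurable
    show "ennreal (norm (G' x)) \<le> g \<lfloor>x\<rfloor>" for x
      by (simp add: G'_def)
    show "AE x in lborel. G x = G' x"
      using ae1 ae2 ae3
    proof eventually_elim
      case (elim x)
      have "real_of_int \<lfloor>x\<rfloor> \<noteq> x"
        using elim(2) Ints_of_int[of "\<lfloor>x\<rfloor>", where 'a = real] by auto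
      then have "real_of_int \<lfloor>x\<rfloor> < x"
        using of_int_floor_le[of x] by (intro le_neq_trans)
      then have "x \<in> {real_of_int \<lfloor>x\<rfloor><..<real_of_int \<lfloor>x\<rfloor> + 1}"
        using real_of_int_floor_add_one_gt[of x] by (auto simp del: floor_of_int)
      then have "ennreal (norm (G x)) \<le> g \<lfloor>x\<rfloor>"
        using elim(1) by blast
      with elim(3) show ?case
        by (simp add: G'_def)
    qed
  qed (fact sum_g)
qed

lemma Lp_norm_lebesgue_eq:
  assumes ae: "AE x in lborel. f x = h x" and h [measurable]: "h \<in> borel_measurable borel"
  shows "Lp_norm p lebesgue f = nn_Lp p lborel (\<lambda>x. ennreal (norm (h x)))"
proof -
  have ae': "AE x in lebesgue. f x = h x"
    using ae by (simp add: AE_completion_iff)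
  have h': "h \<in> borel_measurable lebesgue"
    using h by (intro measurable_completion) simp
  have f: "f \<in> borel_measurable lebesgue"
    by (rule borel_measurable_AE[OF h']) (use ae' in \<open>auto elim: eventually_mono\<close>)
  show ?thesis
  proof (cases "p = top")
    case True
    have "esssup lebesgue (\<lambda>x. ennreal (norm (f x))) = esssup lborel (\<lambda>x. ennreal (norm (h x)))"
    proof -
      have "(AE x in lebesgue. ennreal (norm (f x)) \<le> z) \<longleftrightarrow> (AE x in lborel. ennreal (norm (h x)) \<le> z)" for z
      proof -
        have "AE x in lborel. (ennreal (norm (f x)) \<le> z) = (ennreal (norm (h x)) \<le> z)"
          using ae by eventually_elim simp
        then show ?thesis
          unfolding AE_completion_iff by (rule eventually_subst)
      qed
      then show ?thesis
        using f by (simp add: esssup_eq_AE)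
    qed
    then show ?thesis
      using True f by (simp add: Lp_norm_def nn_Lp_def)
  next
    case False
    have "(\<integral>\<^sup>+x. ennreal_powr (ennreal (norm (f x))) (enn2real p) \<partial>lborel)
        = (\<integral>\<^sup>+x. ennreal_powr (ennreal (norm (h x))) (enn2real p) \<partial>lborel)"
      using ae by (intro nn_integral_cong_AE) auto
    then show ?thesis
      using False f by (simp add: Lp_norm_eq_nn_Lp nn_Lp_def nn_integral_completion)
  qed
qed

lemma AE_translates_eq:
  fixes f h :: "real \<Rightarrow> complex"
  assumes "AE x in lborel. f x = h x" "countable \<Gamma>"
  shows "AE x in lborel. \<forall>\<gamma>\<in>\<Gamma>. f (x - \<gamma>) = h (x - \<gamma>)"
proof -
  obtain E where E: "E \<in> null_sets lborel" "{x \<in> space lborel. f x \<noteq> h x} \<subseteq> E"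
    using assms(1) by (auto simp: eventually_ae_filter)
  have "AE x in lborel. f (x - \<gamma>) = h (x - \<gamma>)" for \<gamma>
  proof -
    have [measurable]: "E \<in> sets borel"
      using E(1) by auto
    have "AE x in lborel. x \<notin> E"
      using E(1) by (rule AE_not_in)
    then have "AE x in lborel. - \<gamma> + 1 * x \<notin> E"
      by (intro AE_borel_affine) auto
    then show ?thesis
      by eventually_elim (use E(2) in auto)
  qed
  then show ?thesis
    using assms(2) by (simp add: AE_ball_countable)
qed

section \<open>Stability for all exponents\<close>

theorem theorem2p11:
  fixes \<Gamma> :: "real set" and G :: "real \<Rightarrow> complex"
  assumes "separated \<Gamma>"
    and "G \<in> wiener_amalgam"
    and "lp_stable 2 \<Gamma> G"
  shows "stable_shifts \<Gamma> G"
proof -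
  obtain K where "relatively_separated \<Gamma> K"
    using assms(1) uniform_discrete_imp_relatively_separated
    by (auto simp: separated_iff_uniform_discrete)
  moreover obtain G' g where G': "G' \<in> borel_measurable borel" "\<And>x. ennreal (norm (G' x)) \<le> g \<lfloor>x\<rfloor>"
    "(\<integral>\<^sup>+k. g k \<partial>count_space UNIV) < top" and ae: "AE x in lborel. G x = G' x"
    by (rule amalgam_representative[OF assms(2)], rule that)
  ultimately interpret amalgam_generator \<Gamma> K G' g
    by (simp add: amalgam_generator_def amalgam_generator_axioms_def)
  have series_eq: "Lp_norm p lebesgue (shift_series \<Gamma> G c)
      = nn_Lp p lborel (\<lambda>x. ennreal (norm (synth c x)))"
    if c: "\<And>\<gamma>. \<gamma> \<in> \<Gamma> \<Longrightarrow> norm (c \<gamma>) \<le> B" "0 \<le> B" for p c B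
  proof (rule Lp_norm_lebesgue_eq)
    show "AE x in lborel. shift_series \<Gamma> G c x = synth c x"
      using AE_translates_eq[OF ae countable]
    proof eventually_elim
      case (elim x)
      then have "shift_series \<Gamma> G c x = shift_series \<Gamma> G' c x"
        unfolding shift_series_def by (intro infsum_cong) simp
      then show ?case
        using shift_series_eq_synth[OF c] by simp
    qed
  qed simp
  have lp_norm_eq: "lp_norm p \<Gamma> c = nn_Lp p (count_space \<Gamma>) (\<lambda>\<gamma>. ennreal (norm (c \<gamma>)))" for p c
    by (rule Lp_norm_eq_nn_Lp) simp
  have series_eq_lp: "Lp_norm p lebesgue (shift_series \<Gamma> G c)
      = nn_Lp p lborel (\<lambda>x. ennreal (norm (synth c x)))"
    if "lp_norm p \<Gamma> c < top" "1 \<le> p" for p c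
  proof (rule series_eq)
    show "norm (c \<gamma>) \<le> enn2real (lp_norm p \<Gamma> c)" if "\<gamma> \<in> \<Gamma>" for \<gamma>
      using enn2real_mono[OF le_nn_Lp_count_space[OF \<open>\<gamma> \<in> \<Gamma>\<close> \<open>1 \<le> p\<close>, of "\<lambda>\<gamma>. ennreal (norm (c \<gamma>))"]]
        \<open>lp_norm p \<Gamma> c < top\<close> by (simp add: lp_norm_eq)
  qed simp
  obtain C1 where C1: "0 < C1" "\<And>c. lp_norm 2 \<Gamma> c < top \<Longrightarrow>
      ennreal C1 * lp_norm 2 \<Gamma> c \<le> Lp_norm 2 lebesgue (shift_series \<Gamma> G c)"
    using assms(3) unfolding lp_stable_def by blast
  \<comment> \<open>Squaring removes the roots from the \<open>l\<^sup>2\<close> stability bound.\<close>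
  have coercive: "ennreal (C1\<^sup>2 * (\<Sum>\<gamma>\<in>S. (norm (b \<gamma>))\<^sup>2)) \<le> (\<integral>\<^sup>+x. ennreal ((norm (synth b x))\<^sup>2) \<partial>lborel)"
    if S: "finite S" "S \<subseteq> \<Gamma>" "\<And>\<gamma>. \<gamma> \<in> \<Gamma> \<Longrightarrow> \<gamma> \<notin> S \<Longrightarrow> b \<gamma> = 0" for b S
  proof -
    have nn_L2: "nn_Lp 2 M (\<lambda>x. ennreal (norm (f x)))
        = ennreal_powr (\<integral>\<^sup>+x. ennreal ((norm (f x))\<^sup>2) \<partial>M) (1 / 2)" for M :: "real measure" and f :: "real \<Rightarrow> complex"
      by (simp add: nn_Lp_def ennreal_powr_ennreal)
    have sum: "(\<integral>\<^sup>+\<gamma>. ennreal ((norm (b \<gamma>))\<^sup>2) \<partial>count_space \<Gamma>) = ennreal (\<Sum>\<gamma>\<in>S. (norm (b \<gamma>))\<^sup>2)"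
      using S by (subst nn_integral_count_space'[OF S(1) _ S(2)]) (auto simp: sum_ennreal)
    have fin: "lp_norm 2 \<Gamma> b < top"
      by (simp add: lp_norm_eq nn_L2 sum less_top[symmetric])
    then have "ennreal C1 * ennreal_powr (ennreal (\<Sum>\<gamma>\<in>S. (norm (b \<gamma>))\<^sup>2)) (1 / 2)
        \<le> ennreal_powr (\<integral>\<^sup>+x. ennreal ((norm (synth b x))\<^sup>2) \<partial>lborel) (1 / 2)"
      using C1(2)[OF fin] series_eq_lp[OF fin] by (simp add: lp_norm_eq nn_L2 sum)
    then have "ennreal_powr (ennreal C1 * ennreal_powr (ennreal (\<Sum>\<gamma>\<in>S. (norm (b \<gamma>))\<^sup>2)) (1 / 2)) 2
        \<le> ennreal_powr (ennreal_powr (\<integral>\<^sup>+x. ennreal ((norm (synth b x))\<^sup>2) \<partial>lborel) (1 / 2)) 2"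
      by (rule ennreal_powr_mono) simp
    moreover have "ennreal_powr (ennreal C1 * ennreal_powr z (1 / 2)) 2 = ennreal (C1\<^sup>2) * z" for z
    proof -
      have "ennreal_powr (ennreal C1) 2 = ennreal (C1\<^sup>2)"
        using C1(1) by (simp add: ennreal_powr_ennreal)
      then show ?thesis
        by (simp add: ennreal_powr_mult ennreal_powr_powr)
    qed
    moreover have "ennreal_powr (ennreal_powr z (1 / 2)) 2 = z" for z
      by (simp add: ennreal_powr_powr)
    moreover have "ennreal (C1\<^sup>2 * (\<Sum>\<gamma>\<in>S. (norm (b \<gamma>))\<^sup>2))
        = ennreal (C1\<^sup>2) * ennreal (\<Sum>\<gamma>\<in>S. (norm (b \<gamma>))\<^sup>2)"
      by (rule ennreal_mult) (simp_all add: sum_nonneg)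
    ultimately show ?thesis
      by simp
  qed
  show ?thesis
    unfolding stable_shifts_def
  proof (intro allI impI)
    fix p :: ennreal assume p: "1 \<le> p"
    obtain A where A: "0 < A" "\<And>c. lp_norm p \<Gamma> c < top \<Longrightarrow>
        lp_norm p \<Gamma> c \<le> ennreal A * nn_Lp p lborel (\<lambda>x. ennreal (norm (synth c x)))"
    proof -
      have "0 < C1\<^sup>2"
        using C1(1) by simp
      from lp_lower_bound[OF this coercive p] show ?thesis
        using that unfolding lp_norm_eq by blast
    qed
    show "lp_stable p \<Gamma> G"
      unfolding lp_stable_def
    proof (intro exI conjI allI impI)
      show "0 < 1 / A" "0 < schur_const"
        using A(1) schur_const_pos by simp_all
      fix c assume c: "lp_norm p \<Gamma> c < top"
      have "ennreal (1 / A) * lp_norm p \<Gamma> c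
          \<le> ennreal (1 / A) * (ennreal A * nn_Lp p lborel (\<lambda>x. ennreal (norm (synth c x))))"
        by (intro mult_left_mono A(2) c) simp
      also have "\<dots> = nn_Lp p lborel (\<lambda>x. ennreal (norm (synth c x)))"
        using A(1) by (simp add: mult.assoc[symmetric] ennreal_mult[symmetric])
      finally show "ennreal (1 / A) * lp_norm p \<Gamma> c \<le> Lp_norm p lebesgue (shift_series \<Gamma> G c)"
        by (simp add: series_eq_lp[OF c p])
      show "Lp_norm p lebesgue (shift_series \<Gamma> G c) \<le> ennreal schur_const * lp_norm p \<Gamma> c"
        unfolding series_eq_lp[OF c p] unfolding lp_norm_eq by (rule nn_Lp_synth_le[OF p])
    qed
  qed
qed

end
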